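(* Every valid sequent is provable in $\mathrm{MTL}^2_\infty$. That is, if a sequent $\Gamma\vdash\Delta$ of formulas in $F_{e,r}\cup F_{e,l}$ is true in every structure, then $\Gamma\vdash\Delta$ is derivable in the sequent calculus $\mathrm{MTL}^2_\infty$.
   Context: **Syntax.** The internal relational language $L_{i,r}=\{f,<,c\}$ is a first-order language with equality ($f$ unary function, $<$ binary relation, $c$ constant), with a countably infinite set $V_i$ of variables $x,y,z,\dots$; $T_i$ is its set of terms $s,t,\dots$. Put $f^0(t)=t$, $f^{n+1}(t)=f(f^n(t))$. The set $F_{i,r}$ of internal relational formulas consists of the finitary first-order $L_{i,r}$-formulas together with the formula $\forall x\bigvee_{n\in\omega}(x<f^n(c))$ and all its subformulas, i.e. also $\bigvee_{n\in\omega}(t<f^n(c))$ and $t<f^k(c)$ for all $t\in T_i$, $k\in\omega$. The external relational language $L_{e,r}=\{F,<,C\}$, its variables $V_e$ ($X,Y,Z,\dots$), terms $T_e$ ($S,T,\dots$) and formulas $F_{e,r}$ are defined in exactly the same way with upper-case symbols. In both languages $u\le v$ abbreviates $u<v\lor u=v$. Temporal operators: for all $m<n$ in $\omega$, $\Box_{[m,n]},\Box_{]m,n]},\Box_{[m,n[},\Box_{]m,n[},\Box_{[m,\infty[},\Box_{]m,\infty[}$; $\Box_{(m,n)}$ denotes any of them ($n\in\omega\cup\{\infty\}$). The set $F_{i,t}$ of internal temporal formulas is the least set containing the propositional letters $\mathbf P=\{p_n:n\in\omega\}$ and closed under the propositional connectives and all $\Box_{(m,n)}$. $F_{i,l}$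 is the set of expressions $s:\psi$ with $s\in T_i$, $\psi\in F_{i,t}$. $\overline F_{i,l}$ is the closure of $F_{i,l}$ under (external) propositional connectives and (external) temporal operators; the elements of $F_{i,l}$ are the atomic formulas of $\overline F_{i,l}$. $F_{e,l}$ is the set of expressions $S:\beta$ with $S\in T_e$ and $\beta\in\overline F_{i,l}\cup F_{i,r}$. A sequent is $\Gamma\vdash\Delta$ with $\Gamma,\Delta$ finite (possibly empty) lists of formulas in $F_{e,r}\cup F_{e,l}$. **Semantics.** Call a first-order structure $(M,<,0,g)$ admissible if $(M,<,0)$ is a dense linear ordering with least element $0$ and no greatest element, $g:M\to M$ is strictly increasing, $a<g(a)$ for all $a\in M$, and $\{g^n(0):n\in\omega\}$ is cofinal in $M$. A pre-structure is $(\mathbf M,\mathbf N_a)_{a\in M}$ with $\mathbf M=(M,<,0,g)$ admissible and, for each $a\in M$, $\mathbf N_a=(N_a,<_a,0_a,g_a)$ admissible. A structure $\mathcal M=(\mathbf M,\mathbf N_a,(p^{\mathbf N_a})_{p\in\mathbf P},\sigma,\sigma_a)_{a\in M}$ based on it consists of it together with subsets $p^{\mathbf N_a}\subseteq N_a$ ($p\in\mathbf P$, $a\in M$), an assignment $\sigma:V_e\to M$ and assignments $\sigma_a:V_i\to N_a$. The symbols $F,<,C$ are interpreted in $\mathbf M$ by $g,<,0$, and $f,<,c$ in $\mathbf N_a$ by $g_a,<_a,0_a$. - Formulas of $F_{e,r}$ are evaluated in $\mathbf M,\sigma$, and formulas of $F_{i,r}$ in $\mathbf N_a,\sigma_a$,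 by first-order semantics (with the obvious meaning of $\bigvee$). - For $t\in T_i$ with value $b$ in $\mathbf N_a,\sigma_a$: $\mathbf N_a,\sigma_a\models t:p$ iff $b\in p^{\mathbf N_a}$; connectives as usual, e.g. $t:\eta\to\xi$ holds iff $t:\eta$ fails or $t:\xi$ holds; $t:\Box_{[m,n]}\psi$ holds iff for all $d\in N_a$ with $g_a^m(b)\le_a d\le_a g_a^n(b)$, $\mathbf N_a,\sigma_a(x/d)\models x:\psi$ (where $\sigma_a(x/d)$ sends $x$ to $d$ and otherwise agrees with $\sigma_a$). For the other operators, an endpoint whose bracket is turned outwards gives the corresponding strict inequality, and if the right endpoint is $\infty$ there is no upper bound. - For $T\in T_e$ with value $a$ in $\mathbf M,\sigma$: $\mathcal M\models T:\varphi$ (for $\varphi\in F_{i,r}$) iff $\mathbf N_a,\sigma_a\models\varphi$; $\mathcal M\models T:t:\psi$ iff $\mathbf N_a,\sigma_a\models t:\psi$; connectives as usual; $\mathcal M\models T:\Box_{[m,n]}\eta$ (for $\eta\in\overline F_{i,l}$) iff for all $d\in M$ with $g^m(a)\le d\le g^n(a)$, the structure obtained from $\mathcal M$ by replacing $\sigma$ with $\sigma(X/d)$ satisfies $X:\eta$; other operators similarly. A sequent $\Gamma\vdash\Delta$ is true in $\mathcal M$ if $\mathcal M$ fails to satisfy some formula of $\Gamma$ or satisfies some formula of $\Delta$; it is valid if true in all structures. **The calculus $\mathrm{MTL}^2_\infty$.** Axioms (an instance of a schema is obtained by replacing its displayed variables by arbitrary terms of the same kind): 1. *id*: $A\vdash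 A$ for every $A\in F_{e,r}\cup F_{e,l}$. 2. Equality axioms: all instances of $\vdash X=X$ and $X=Y,\rho[X/Z]\vdash\rho[Y/Z]$ ($\rho$ atomic in $F_{e,r}$); all instances of $\vdash T:x=x$ and $T:x=y,\ T:\rho[x/z]\vdash T:\rho[y/z]$ ($T\in T_e$, $\rho$ atomic in $F_{i,r}$); $T=S,\ T:\eta\vdash S:\eta$ for $S,T\in T_e$, $\eta$ atomic in $\overline F_{i,l}\cup F_{i,r}$; and its internal version $T:t=s,\ T:t:p\vdash T:s:p$ ($T\in T_e$, $s,t\in T_i$, $p\in\mathbf P$). 3. External extralogical axioms, all instances of: $X<X\vdash$; $X<Y,Y<Z\vdash X<Z$; $\vdash X<Y,X=Y,Y<X$; $\vdash C<X,C=X$; $X<Y\vdash\exists Z(X<Z\land Z<Y)$; $\vdash X<F(X)$; $X<Y\vdash F(X)<F(Y)$; $\vdash\bigvee_{n\in\omega}(X<F^n(C))$. Internal extralogical axioms: the same with $x,y,z,f,c$ in place of $X,Y,Z,F,C$ and every formula prefixed by the same label $T:$, for each $T\in T_e$. Rules: - Cut (from $\Gamma\vdash A,\Delta$ and $\Gamma,A\vdash\Delta$ infer $\Gamma\vdash\Delta$), Weakening, Exchange, Contraction, for all formulas of $F_{e,r}\cup F_{e,l}$. - For external relational formulas: the usual left and right rules of first-order classical sequent calculus for the finitary connectives and quantifiers (with the usual eigenvariable conditions), and for infinitary disjunction: from $\{\Gamma,T<F^n(C)\vdash\Delta\}_{n\in\omega}$ infer $\Gamma,\bigvee_{n\in\omega}(T<F^n(C))\vdash\Delta$;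 from $\Gamma\vdash T<F^m(C),\Delta$ (any $m\in\omega$) infer $\Gamma\vdash\bigvee_{n\in\omega}(T<F^n(C)),\Delta$. The same rules, internally, for formulas $T:\rho$ with $\rho\in F_{i,r}$ (all active formulas carry the same label $T$). - Propositional rules for labelled formulas: the usual left and right rules with the label $T$ attached to all active formulas $T:\alpha$, $T:\beta$, where $\alpha,\beta\in\overline F_{i,l}$ or $\alpha,\beta\in F_{i,r}$; and the internal versions with double label $T:t:$ attached to active formulas $\eta,\xi\in F_{i,t}$. E.g. from $\Gamma,T:t:\eta\vdash T:t:\xi,\Delta$ infer $\Gamma\vdash T:t:\eta\to\xi,\Delta$. - External temporal rules for $\Box_{[m,n]}$ ($\alpha\in\overline F_{i,l}$). Right: from $\Gamma,F^m(T)\le X,X\le F^n(T)\vdash X:\alpha,\Delta$ infer $\Gamma\vdash T:\Box_{[m,n]}\alpha,\Delta$, where $X$ is not free in $\Gamma\cup\Delta\cup\{T\}$. Left: from $\Gamma\vdash F^m(T)\le S,\Delta$; $\Gamma\vdash S\le F^n(T),\Delta$; and $\Gamma,S:\alpha\vdash\Delta$ infer $\Gamma,T:\Box_{[m,n]}\alpha\vdash\Delta$. - Internal temporal rules for $\Box_{[m,n]}$ ($\eta\in F_{i,t}$). Right: from $\Gamma,T:f^m(t)\le x,T:x\le f^n(t)\vdash T:x:\eta,\Delta$ infer $\Gamma\vdash T:t:\Box_{[m,n]}\eta,\Delta$, where $x$ is not free in $\Gamma\cup\Delta\cup\{t\}$. Left: from $\Gamma\vdash T:f^m(t)\le s,\Delta$;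 $\Gamma\vdash T:s\le f^n(t),\Delta$; and $\Gamma,T:s:\eta\vdash\Delta$ infer $\Gamma,T:t:\Box_{[m,n]}\eta\vdash\Delta$. - For the other temporal operators the rules are the same with $\le$ replaced by $<$ at each open endpoint, and with the upper-bound formula (respectively premise) omitted when the right endpoint is $\infty$. Proofs are well-founded derivation trees (each branch finite, the height possibly infinite because of the infinitary rules) whose leaves are axioms; a sequent is provable if it has a proof. *)

theory Defs
  imports Main
begin

section \<open>Syntax\<close>

text \<open>
  The internal and the external relational language have the same shape; they are kept apart by
  the type of their variables.
\<close>

datatype ivar = IVar nat
datatype evar = EVar nat

datatype 'v tm = Var 'v | Cst | Fn "'v tm"

datatype 'v fo =
    Eq "'v tm" "'v tm"
  | Less "'v tm" "'v tm"
  | Neg "'v fo"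
  | Conj "'v fo" "'v fo"
  | Disj "'v fo" "'v fo"
  | Imp "'v fo" "'v fo"
  | Forall 'v "'v fo"
  | Exists 'v "'v fo"

abbreviation Leq :: "'v tm \<Rightarrow> 'v tm \<Rightarrow> 'v fo" where
  "Leq u v \<equiv> Disj (Less u v) (Eq u v)"

text \<open>
  Relational formulas: the finitary ones, \<open>InfOr t\<close> for the infinitary disjunction
  \<open>\<Or>n. t < f\<^sup>n(c)\<close>, and \<open>AllInfOr x\<close> for \<open>\<forall>x. \<Or>n. x < f\<^sup>n(c)\<close>. The infinitary formulas are not
  combined any further. The remaining subformulas \<open>t < f\<^sup>k(c)\<close> are finitary.
\<close>

datatype 'v rfm = FO "'v fo" | InfOr "'v tm" | AllInfOr 'v

text \<open>
  The index of a temporal operator: \<open>(b, m, u)\<close> has left endpoint \<open>m\<close>, excluded iff \<open>b\<close>;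
  \<open>u = None\<close> stands for the right endpoint \<open>\<infinity>\<close>, and \<open>u = Some (b', n)\<close> for the right endpoint
  \<open>n\<close>, excluded iff \<open>b'\<close>.
\<close>

typedef interval =
  "{(b :: bool, m :: nat, u :: (bool \<times> nat) option). \<forall>b' n. u = Some (b', n) \<longrightarrow> m < n}"
  by (rule exI[of _ "(False, 0, None)"]) simp

text \<open>Internal temporal formulas \<open>\<psi>\<close>, built from the propositional letters \<open>p\<^sub>n\<close>.\<close>

datatype tfm =
    Letter nat
  | TNeg tfm
  | TConj tfm tfm
  | TDisj tfm tfm
  | TImp tfm tfm
  | TBox interval tfm

text \<open>
  The closure of the internal labelled formulas \<open>s : \<psi>\<close> (here \<open>At s \<psi>\<close>) under the external
  connectives and the external temporal operators.
\<close>

datatype lfm =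
    At "ivar tm" tfm
  | LNeg lfm
  | LConj lfm lfm
  | LDisj lfm lfm
  | LImp lfm lfm
  | LBox interval lfm

text \<open>
  The formulas occurring in sequents: external relational formulas, and labelled formulas
  \<open>S : \<beta>\<close> where \<open>\<beta>\<close> is an internal relational formula (\<open>LabR\<close>) or a formula of type
  \<^typ>\<open>lfm\<close> (\<open>LabL\<close>).
\<close>

datatype fm =
    ERel "evar rfm"
  | LabR "evar tm" "ivar rfm"
  | LabL "evar tm" lfm

datatype 'f sequent = Sequent "'f list" "'f list"  (infix "\<turnstile>" 60)

subsection \<open>Free variables and substitution\<close>

fun tm_vars :: "'v tm \<Rightarrow> 'v set" where
  "tm_vars (Var x) = {x}"
| "tm_vars Cst = {}"
| "tm_vars (Fn t) = tm_vars t"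

fun tm_subst :: "'v \<Rightarrow> 'v tm \<Rightarrow> 'v tm \<Rightarrow> 'v tm" where
  "tm_subst x s (Var y) = (if y = x then s else Var y)"
| "tm_subst x s Cst = Cst"
| "tm_subst x s (Fn t) = Fn (tm_subst x s t)"

fun fo_fv :: "'v fo \<Rightarrow> 'v set" where
  "fo_fv (Eq s t) = tm_vars s \<union> tm_vars t"
| "fo_fv (Less s t) = tm_vars s \<union> tm_vars t"
| "fo_fv (Neg \<phi>) = fo_fv \<phi>"
| "fo_fv (Conj \<phi> \<psi>) = fo_fv \<phi> \<union> fo_fv \<psi>"
| "fo_fv (Disj \<phi> \<psi>) = fo_fv \<phi> \<union> fo_fv \<psi>"
| "fo_fv (Imp \<phi> \<psi>) = fo_fv \<phi> \<union> fo_fv \<psi>"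
| "fo_fv (Forall x \<phi>) = fo_fv \<phi> - {x}"
| "fo_fv (Exists x \<phi>) = fo_fv \<phi> - {x}"

text \<open>
  Substitution does not rename bound variables; it is only meaningful together with the
  condition \<open>free_for x s \<phi>\<close> that no variable of \<open>s\<close> is captured.
\<close>

fun fo_subst :: "'v \<Rightarrow> 'v tm \<Rightarrow> 'v fo \<Rightarrow> 'v fo" where
  "fo_subst x s (Eq t u) = Eq (tm_subst x s t) (tm_subst x s u)"
| "fo_subst x s (Less t u) = Less (tm_subst x s t) (tm_subst x s u)"
| "fo_subst x s (Neg \<phi>) = Neg (fo_subst x s \<phi>)"
| "fo_subst x s (Conj \<phi> \<psi>) = Conj (fo_subst x s \<phi>) (fo_subst x s \<psi>)"
| "fo_subst x s (Disj \<phi> \<psi>) = Disj (fo_subst x s \<phi>) (fo_subst x s \<psi>)"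
| "fo_subst x s (Imp \<phi> \<psi>) = Imp (fo_subst x s \<phi>) (fo_subst x s \<psi>)"
| "fo_subst x s (Forall y \<phi>) = Forall y (if y = x then \<phi> else fo_subst x s \<phi>)"
| "fo_subst x s (Exists y \<phi>) = Exists y (if y = x then \<phi> else fo_subst x s \<phi>)"

fun free_for :: "'v \<Rightarrow> 'v tm \<Rightarrow> 'v fo \<Rightarrow> bool" where
  "free_for x s (Eq t u) \<longleftrightarrow> True"
| "free_for x s (Less t u) \<longleftrightarrow> True"
| "free_for x s (Neg \<phi>) \<longleftrightarrow> free_for x s \<phi>"
| "free_for x s (Conj \<phi> \<psi>) \<longleftrightarrow> free_for x s \<phi> \<and> free_for x s \<psi>"
| "free_for x s (Disj \<phi> \<psi>) \<longleftrightarrow> free_for x s \<phi> \<and> free_for x s \<psi>"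
| "free_for x s (Imp \<phi> \<psi>) \<longleftrightarrow> free_for x s \<phi> \<and> free_for x s \<psi>"
| "free_for x s (Forall y \<phi>) \<longleftrightarrow> x \<notin> fo_fv (Forall y \<phi>) \<or> y \<notin> tm_vars s \<and> free_for x s \<phi>"
| "free_for x s (Exists y \<phi>) \<longleftrightarrow> x \<notin> fo_fv (Exists y \<phi>) \<or> y \<notin> tm_vars s \<and> free_for x s \<phi>"

fun atomic :: "'v fo \<Rightarrow> bool" where
  "atomic (Eq s t) \<longleftrightarrow> True"
| "atomic (Less s t) \<longleftrightarrow> True"
| "atomic _ \<longleftrightarrow> False"

fun rfm_fv :: "'v rfm \<Rightarrow> 'v set" where
  "rfm_fv (FO \<phi>) = fo_fv \<phi>"
| "rfm_fv (InfOr t) = tm_vars t"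
| "rfm_fv (AllInfOr x) = {}"

fun lfm_fv :: "lfm \<Rightarrow> ivar set" where
  "lfm_fv (At t \<psi>) = tm_vars t"
| "lfm_fv (LNeg \<alpha>) = lfm_fv \<alpha>"
| "lfm_fv (LConj \<alpha> \<beta>) = lfm_fv \<alpha> \<union> lfm_fv \<beta>"
| "lfm_fv (LDisj \<alpha> \<beta>) = lfm_fv \<alpha> \<union> lfm_fv \<beta>"
| "lfm_fv (LImp \<alpha> \<beta>) = lfm_fv \<alpha> \<union> lfm_fv \<beta>"
| "lfm_fv (LBox I \<alpha>) = lfm_fv \<alpha>"

fun ext_fv :: "fm \<Rightarrow> evar set" where
  "ext_fv (ERel \<rho>) = rfm_fv \<rho>"
| "ext_fv (LabR T \<rho>) = tm_vars T"
| "ext_fv (LabL T \<alpha>) = tm_vars T"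

fun int_fv :: "fm \<Rightarrow> ivar set" where
  "int_fv (ERel \<rho>) = {}"
| "int_fv (LabR T \<rho>) = rfm_fv \<rho>"
| "int_fv (LabL T \<alpha>) = lfm_fv \<alpha>"


section \<open>Semantics\<close>

record 'a ordstr =
  carr :: "'a set"
  lt :: "'a \<Rightarrow> 'a \<Rightarrow> bool"
  origin :: 'a
  step :: "'a \<Rightarrow> 'a"

definition le :: "'a ordstr \<Rightarrow> 'a \<Rightarrow> 'a \<Rightarrow> bool" where
  "le A a b \<longleftrightarrow> lt A a b \<or> a = b"

definition admissible :: "'a ordstr \<Rightarrow> bool" where
  "admissible A \<longleftrightarrow>
     origin A \<in> carr A \<and> step A ` carr A \<subseteq> carr A \<and>
     irreflp_on (carr A) (lt A) \<and> transp_on (carr A) (lt A) \<and> totalp_on (carr A) (lt A) \<and>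
     (\<forall>a\<in>carr A. \<forall>b\<in>carr A. lt A a b \<longrightarrow> (\<exists>c\<in>carr A. lt A a c \<and> lt A c b)) \<and>
     (\<forall>a\<in>carr A. le A (origin A) a) \<and>
     (\<forall>a\<in>carr A. \<exists>b\<in>carr A. lt A a b) \<and>
     monotone_on (carr A) (lt A) (lt A) (step A) \<and>
     (\<forall>a\<in>carr A. lt A a (step A a)) \<and>
     (\<forall>a\<in>carr A. \<exists>n. le A a ((step A ^^ n) (origin A)))"

record ('m, 'n) struct =
  base :: "'m ordstr"
  node :: "'m \<Rightarrow> 'n ordstr"
  letter :: "'m \<Rightarrow> nat \<Rightarrow> 'n set"
  easg :: "evar \<Rightarrow> 'm"
  iasg :: "'m \<Rightarrow> ivar \<Rightarrow> 'n"

definition is_structure :: "('m, 'n) struct \<Rightarrow> bool" where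
  "is_structure \<M> \<longleftrightarrow>
     admissible (base \<M>) \<and> range (easg \<M>) \<subseteq> carr (base \<M>) \<and>
     (\<forall>a\<in>carr (base \<M>).
        admissible (node \<M> a) \<and>
        (\<forall>k. letter \<M> a k \<subseteq> carr (node \<M> a)) \<and>
        range (iasg \<M> a) \<subseteq> carr (node \<M> a))"

fun tm_val :: "'a ordstr \<Rightarrow> ('v \<Rightarrow> 'a) \<Rightarrow> 'v tm \<Rightarrow> 'a" where
  "tm_val A \<sigma> (Var x) = \<sigma> x"
| "tm_val A \<sigma> Cst = origin A"
| "tm_val A \<sigma> (Fn t) = step A (tm_val A \<sigma> t)"

fun fo_sat :: "'a ordstr \<Rightarrow> ('v \<Rightarrow> 'a) \<Rightarrow> 'v fo \<Rightarrow> bool" where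
  "fo_sat A \<sigma> (Eq s t) \<longleftrightarrow> tm_val A \<sigma> s = tm_val A \<sigma> t"
| "fo_sat A \<sigma> (Less s t) \<longleftrightarrow> lt A (tm_val A \<sigma> s) (tm_val A \<sigma> t)"
| "fo_sat A \<sigma> (Neg \<phi>) \<longleftrightarrow> \<not> fo_sat A \<sigma> \<phi>"
| "fo_sat A \<sigma> (Conj \<phi> \<psi>) \<longleftrightarrow> fo_sat A \<sigma> \<phi> \<and> fo_sat A \<sigma> \<psi>"
| "fo_sat A \<sigma> (Disj \<phi> \<psi>) \<longleftrightarrow> fo_sat A \<sigma> \<phi> \<or> fo_sat A \<sigma> \<psi>"
| "fo_sat A \<sigma> (Imp \<phi> \<psi>) \<longleftrightarrow> (fo_sat A \<sigma> \<phi> \<longrightarrow> fo_sat A \<sigma> \<psi>)"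
| "fo_sat A \<sigma> (Forall x \<phi>) \<longleftrightarrow> (\<forall>d\<in>carr A. fo_sat A (\<sigma>(x := d)) \<phi>)"
| "fo_sat A \<sigma> (Exists x \<phi>) \<longleftrightarrow> (\<exists>d\<in>carr A. fo_sat A (\<sigma>(x := d)) \<phi>)"

fun rfm_sat :: "'a ordstr \<Rightarrow> ('v \<Rightarrow> 'a) \<Rightarrow> 'v rfm \<Rightarrow> bool" where
  "rfm_sat A \<sigma> (FO \<phi>) \<longleftrightarrow> fo_sat A \<sigma> \<phi>"
| "rfm_sat A \<sigma> (InfOr t) \<longleftrightarrow> (\<exists>n. fo_sat A \<sigma> (Less t ((Fn ^^ n) Cst)))"
| "rfm_sat A \<sigma> (AllInfOr x) \<longleftrightarrow>
     (\<forall>d\<in>carr A. \<exists>n. fo_sat A (\<sigma>(x := d)) (Less (Var x) ((Fn ^^ n) Cst)))"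

definition in_interval :: "'a ordstr \<Rightarrow> interval \<Rightarrow> 'a \<Rightarrow> 'a \<Rightarrow> bool" where
  "in_interval A I a d \<longleftrightarrow>
     (case Rep_interval I of (b, m, u) \<Rightarrow>
        (if b then lt A else le A) ((step A ^^ m) a) d \<and>
        (case u of None \<Rightarrow> True
         | Some (b', n) \<Rightarrow> (if b' then lt A else le A) d ((step A ^^ n) a)))"

text \<open>
  The truth of \<open>t : \<psi>\<close> depends on \<open>t\<close> and the assignment only through the value \<open>b\<close> of \<open>t\<close>, so
  satisfaction of a temporal formula is defined at a point: updating an assignment at \<open>x\<close> to \<open>d\<close>
  and evaluating \<open>x : \<psi>\<close> is evaluating \<open>\<psi>\<close> at \<open>d\<close>. Likewise for external labels below.
\<close>

fun tfm_sat :: "'n ordstr \<Rightarrow> (nat \<Rightarrow> 'n set) \<Rightarrow> 'n \<Rightarrow> tfm \<Rightarrow> bool" where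
  "tfm_sat A P b (Letter k) \<longleftrightarrow> b \<in> P k"
| "tfm_sat A P b (TNeg \<psi>) \<longleftrightarrow> \<not> tfm_sat A P b \<psi>"
| "tfm_sat A P b (TConj \<psi> \<chi>) \<longleftrightarrow> tfm_sat A P b \<psi> \<and> tfm_sat A P b \<chi>"
| "tfm_sat A P b (TDisj \<psi> \<chi>) \<longleftrightarrow> tfm_sat A P b \<psi> \<or> tfm_sat A P b \<chi>"
| "tfm_sat A P b (TImp \<psi> \<chi>) \<longleftrightarrow> (tfm_sat A P b \<psi> \<longrightarrow> tfm_sat A P b \<chi>)"
| "tfm_sat A P b (TBox I \<psi>) \<longleftrightarrow> (\<forall>d\<in>carr A. in_interval A I b d \<longrightarrow> tfm_sat A P d \<psi>)"

fun lfm_sat :: "('m, 'n) struct \<Rightarrow> 'm \<Rightarrow> lfm \<Rightarrow> bool" where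
  "lfm_sat \<M> a (At t \<psi>) \<longleftrightarrow>
     tfm_sat (node \<M> a) (letter \<M> a) (tm_val (node \<M> a) (iasg \<M> a) t) \<psi>"
| "lfm_sat \<M> a (LNeg \<alpha>) \<longleftrightarrow> \<not> lfm_sat \<M> a \<alpha>"
| "lfm_sat \<M> a (LConj \<alpha> \<beta>) \<longleftrightarrow> lfm_sat \<M> a \<alpha> \<and> lfm_sat \<M> a \<beta>"
| "lfm_sat \<M> a (LDisj \<alpha> \<beta>) \<longleftrightarrow> lfm_sat \<M> a \<alpha> \<or> lfm_sat \<M> a \<beta>"
| "lfm_sat \<M> a (LImp \<alpha> \<beta>) \<longleftrightarrow> (lfm_sat \<M> a \<alpha> \<longrightarrow> lfm_sat \<M> a \<beta>)"
| "lfm_sat \<M> a (LBox I \<alpha>) \<longleftrightarrow>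
     (\<forall>d\<in>carr (base \<M>). in_interval (base \<M>) I a d \<longrightarrow> lfm_sat \<M> d \<alpha>)"

fun sat :: "('m, 'n) struct \<Rightarrow> fm \<Rightarrow> bool" where
  "sat \<M> (ERel \<rho>) \<longleftrightarrow> rfm_sat (base \<M>) (easg \<M>) \<rho>"
| "sat \<M> (LabR T \<rho>) \<longleftrightarrow>
     (let a = tm_val (base \<M>) (easg \<M>) T in rfm_sat (node \<M> a) (iasg \<M> a) \<rho>)"
| "sat \<M> (LabL T \<alpha>) \<longleftrightarrow> lfm_sat \<M> (tm_val (base \<M>) (easg \<M>) T) \<alpha>"

fun true_in :: "('m, 'n) struct \<Rightarrow> fm sequent \<Rightarrow> bool" where
  "true_in \<M> (\<Gamma> \<turnstile> \<Delta>) \<longleftrightarrow> (\<exists>A\<in>set \<Gamma>. \<not> sat \<M> A) \<or> (\<exists>B\<in>set \<Delta>. sat \<M> B)"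


section \<open>The calculus\<close>

text \<open>
  The external and the internal versions of an axiom or rule have the same shape, so each is
  stated once, relative to an embedding \<open>E\<close> that puts an active formula into a sequent (with its
  label, in the labelled cases). A rule is a relation between its set of premises and its
  conclusion.
\<close>

inductive rel_axiom :: "('v rfm \<Rightarrow> fm) \<Rightarrow> fm sequent \<Rightarrow> bool" for E where
  eq_refl: "rel_axiom E ([] \<turnstile> [E (FO (Eq t t))])"
| eq_subst: "atomic \<rho> \<Longrightarrow>
    rel_axiom E ([E (FO (Eq s t)), E (FO (fo_subst z s \<rho>))] \<turnstile> [E (FO (fo_subst z t \<rho>))])"
| less_irrefl: "rel_axiom E ([E (FO (Less t t))] \<turnstile> [])"
| less_trans: "rel_axiom E ([E (FO (Less s t)), E (FO (Less t u))] \<turnstile> [E (FO (Less s u))])"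
| less_total: "rel_axiom E ([] \<turnstile> [E (FO (Less s t)), E (FO (Eq s t)), E (FO (Less t s))])"
| least: "rel_axiom E ([] \<turnstile> [E (FO (Less Cst t)), E (FO (Eq Cst t))])"
| dense: "z \<notin> tm_vars s \<union> tm_vars t \<Longrightarrow>
    rel_axiom E ([E (FO (Less s t))] \<turnstile>
      [E (FO (Exists z (Conj (Less s (Var z)) (Less (Var z) t))))])"
| less_Fn: "rel_axiom E ([] \<turnstile> [E (FO (Less t (Fn t)))])"
| Fn_mono: "rel_axiom E ([E (FO (Less s t))] \<turnstile> [E (FO (Less (Fn s) (Fn t)))])"
| cofinal: "rel_axiom E ([] \<turnstile> [E (InfOr t)])"

inductive prop_rule ::
  "('f \<Rightarrow> 'f) \<Rightarrow> ('f \<Rightarrow> 'f \<Rightarrow> 'f) \<Rightarrow> ('f \<Rightarrow> 'f \<Rightarrow> 'f) \<Rightarrow> ('f \<Rightarrow> 'f \<Rightarrow> 'f) \<Rightarrow> ('f \<Rightarrow> fm) \<Rightarrow>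
   fm sequent set \<Rightarrow> fm sequent \<Rightarrow> bool"
  for neg conj disj imp E where
  negL: "prop_rule neg conj disj imp E {\<Gamma> \<turnstile> E \<phi> # \<Delta>} (\<Gamma> @ [E (neg \<phi>)] \<turnstile> \<Delta>)"
| negR: "prop_rule neg conj disj imp E {\<Gamma> @ [E \<phi>] \<turnstile> \<Delta>} (\<Gamma> \<turnstile> E (neg \<phi>) # \<Delta>)"
| conjL: "prop_rule neg conj disj imp E {\<Gamma> @ [E \<phi>, E \<psi>] \<turnstile> \<Delta>} (\<Gamma> @ [E (conj \<phi> \<psi>)] \<turnstile> \<Delta>)"
| conjR: "prop_rule neg conj disj imp E {\<Gamma> \<turnstile> E \<phi> # \<Delta>, \<Gamma> \<turnstile> E \<psi> # \<Delta>} (\<Gamma> \<turnstile> E (conj \<phi> \<psi>) # \<Delta>)"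
| disjL: "prop_rule neg conj disj imp E {\<Gamma> @ [E \<phi>] \<turnstile> \<Delta>, \<Gamma> @ [E \<psi>] \<turnstile> \<Delta>} (\<Gamma> @ [E (disj \<phi> \<psi>)] \<turnstile> \<Delta>)"
| disjR: "prop_rule neg conj disj imp E {\<Gamma> \<turnstile> E \<phi> # E \<psi> # \<Delta>} (\<Gamma> \<turnstile> E (disj \<phi> \<psi>) # \<Delta>)"
| impL: "prop_rule neg conj disj imp E {\<Gamma> \<turnstile> E \<phi> # \<Delta>, \<Gamma> @ [E \<psi>] \<turnstile> \<Delta>} (\<Gamma> @ [E (imp \<phi> \<psi>)] \<turnstile> \<Delta>)"
| impR: "prop_rule neg conj disj imp E {\<Gamma> @ [E \<phi>] \<turnstile> E \<psi> # \<Delta>} (\<Gamma> \<turnstile> E (imp \<phi> \<psi>) # \<Delta>)"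

text \<open>
  Rules for relational formulas. The parameter \<open>fv\<close> gives the free variables of the kind of the
  eigenvariable. The last two rules are the quantifier rules for the formula \<open>AllInfOr x\<close>.
\<close>

inductive rel_rule ::
  "('v rfm \<Rightarrow> fm) \<Rightarrow> (fm \<Rightarrow> 'v set) \<Rightarrow> fm sequent set \<Rightarrow> fm sequent \<Rightarrow> bool"
  for E fv where
  connective: "prop_rule Neg Conj Disj Imp (\<lambda>\<phi>. E (FO \<phi>)) Ps S \<Longrightarrow> rel_rule E fv Ps S"
| forallL: "free_for x t \<phi> \<Longrightarrow>
    rel_rule E fv {\<Gamma> @ [E (FO (fo_subst x t \<phi>))] \<turnstile> \<Delta>} (\<Gamma> @ [E (FO (Forall x \<phi>))] \<turnstile> \<Delta>)"
| forallR: "free_for x (Var y) \<phi> \<Longrightarrow> y \<notin> fo_fv (Forall x \<phi>) \<Longrightarrow> y \<notin> (\<Union>A\<in>set (\<Gamma> @ \<Delta>). fv A) \<Longrightarrow>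
    rel_rule E fv {\<Gamma> \<turnstile> E (FO (fo_subst x (Var y) \<phi>)) # \<Delta>} (\<Gamma> \<turnstile> E (FO (Forall x \<phi>)) # \<Delta>)"
| existsL: "free_for x (Var y) \<phi> \<Longrightarrow> y \<notin> fo_fv (Exists x \<phi>) \<Longrightarrow> y \<notin> (\<Union>A\<in>set (\<Gamma> @ \<Delta>). fv A) \<Longrightarrow>
    rel_rule E fv {\<Gamma> @ [E (FO (fo_subst x (Var y) \<phi>))] \<turnstile> \<Delta>} (\<Gamma> @ [E (FO (Exists x \<phi>))] \<turnstile> \<Delta>)"
| existsR: "free_for x t \<phi> \<Longrightarrow>
    rel_rule E fv {\<Gamma> \<turnstile> E (FO (fo_subst x t \<phi>)) # \<Delta>} (\<Gamma> \<turnstile> E (FO (Exists x \<phi>)) # \<Delta>)"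
| infOrL: "rel_rule E fv (range (\<lambda>n. \<Gamma> @ [E (FO (Less t ((Fn ^^ n) Cst)))] \<turnstile> \<Delta>))
    (\<Gamma> @ [E (InfOr t)] \<turnstile> \<Delta>)"
| infOrR: "rel_rule E fv {\<Gamma> \<turnstile> E (FO (Less t ((Fn ^^ n) Cst))) # \<Delta>} (\<Gamma> \<turnstile> E (InfOr t) # \<Delta>)"
| allInfOrL: "rel_rule E fv {\<Gamma> @ [E (InfOr t)] \<turnstile> \<Delta>} (\<Gamma> @ [E (AllInfOr x)] \<turnstile> \<Delta>)"
| allInfOrR: "y \<notin> (\<Union>A\<in>set (\<Gamma> @ \<Delta>). fv A) \<Longrightarrow>
    rel_rule E fv {\<Gamma> \<turnstile> E (InfOr (Var y)) # \<Delta>} (\<Gamma> \<turnstile> E (AllInfOr x) # \<Delta>)"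

text \<open>
  The formulas stating that \<open>s\<close> lies in the interval \<open>I\<close> relative to \<open>t\<close>: a lower bound, and an
  upper bound unless the right endpoint is \<open>\<infinity>\<close>.
\<close>

definition bounds :: "interval \<Rightarrow> 'v tm \<Rightarrow> 'v tm \<Rightarrow> 'v fo list" where
  "bounds I t s =
     (case Rep_interval I of (b, m, u) \<Rightarrow>
        (if b then Less else Leq) ((Fn ^^ m) t) s #
        (case u of None \<Rightarrow> []
         | Some (b', n) \<Rightarrow> [(if b' then Less else Leq) s ((Fn ^^ n) t)]))"

text \<open>
  Temporal rules: \<open>L t \<alpha>\<close> is the formula \<open>\<alpha>\<close> labelled by \<open>t\<close>, \<open>box\<close> the temporal operator, and
  \<open>E\<close> the embedding of the bounding formulas.
\<close>

inductive box_rule ::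
  "('v tm \<Rightarrow> 'f \<Rightarrow> fm) \<Rightarrow> (interval \<Rightarrow> 'f \<Rightarrow> 'f) \<Rightarrow> ('v rfm \<Rightarrow> fm) \<Rightarrow> (fm \<Rightarrow> 'v set) \<Rightarrow>
   fm sequent set \<Rightarrow> fm sequent \<Rightarrow> bool"
  for L box E fv where
  boxR: "x \<notin> (\<Union>A\<in>set (\<Gamma> @ \<Delta>). fv A) \<union> tm_vars t \<Longrightarrow>
    box_rule L box E fv
      {\<Gamma> @ map (\<lambda>\<phi>. E (FO \<phi>)) (bounds I t (Var x)) \<turnstile> L (Var x) \<alpha> # \<Delta>}
      (\<Gamma> \<turnstile> L t (box I \<alpha>) # \<Delta>)"
| boxL: "box_rule L box E fv
      (insert (\<Gamma> @ [L s \<alpha>] \<turnstile> \<Delta>) ((\<lambda>\<phi>. \<Gamma> \<turnstile> E (FO \<phi>) # \<Delta>) ` set (bounds I t s)))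
      (\<Gamma> @ [L t (box I \<alpha>)] \<turnstile> \<Delta>)"

inductive mtl_rule :: "fm sequent set \<Rightarrow> fm sequent \<Rightarrow> bool" where
  identity: "mtl_rule {} ([A] \<turnstile> [A])"
| ext_axiom: "rel_axiom ERel S \<Longrightarrow> mtl_rule {} S"
| int_axiom: "rel_axiom (LabR T) S \<Longrightarrow> mtl_rule {} S"
| label_eqR: "atomic \<rho> \<Longrightarrow>
    mtl_rule {} ([ERel (FO (Eq T S)), LabR T (FO \<rho>)] \<turnstile> [LabR S (FO \<rho>)])"
| label_eqL: "mtl_rule {} ([ERel (FO (Eq T S)), LabL T (At t \<psi>)] \<turnstile> [LabL S (At t \<psi>)])"
| letter_eq: "mtl_rule {}
    ([LabR T (FO (Eq t s)), LabL T (At t (Letter k))] \<turnstile> [LabL T (At s (Letter k))])"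
| cut: "mtl_rule {\<Gamma> \<turnstile> A # \<Delta>, \<Gamma> @ [A] \<turnstile> \<Delta>} (\<Gamma> \<turnstile> \<Delta>)"
| weakenL: "mtl_rule {\<Gamma> \<turnstile> \<Delta>} (\<Gamma> @ [A] \<turnstile> \<Delta>)"
| weakenR: "mtl_rule {\<Gamma> \<turnstile> \<Delta>} (\<Gamma> \<turnstile> A # \<Delta>)"
| exchangeL: "mtl_rule {\<Gamma> @ [A, B] @ \<Gamma>' \<turnstile> \<Delta>} (\<Gamma> @ [B, A] @ \<Gamma>' \<turnstile> \<Delta>)"
| exchangeR: "mtl_rule {\<Gamma> \<turnstile> \<Delta> @ [A, B] @ \<Delta>'} (\<Gamma> \<turnstile> \<Delta> @ [B, A] @ \<Delta>')"
| contractL: "mtl_rule {\<Gamma> @ [A, A] \<turnstile> \<Delta>} (\<Gamma> @ [A] \<turnstile> \<Delta>)"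
| contractR: "mtl_rule {\<Gamma> \<turnstile> A # A # \<Delta>} (\<Gamma> \<turnstile> A # \<Delta>)"
| ext_rel: "rel_rule ERel ext_fv Ps S \<Longrightarrow> mtl_rule Ps S"
| int_rel: "rel_rule (LabR T) int_fv Ps S \<Longrightarrow> mtl_rule Ps S"
| ext_prop: "prop_rule LNeg LConj LDisj LImp (LabL T) Ps S \<Longrightarrow> mtl_rule Ps S"
| int_prop: "prop_rule TNeg TConj TDisj TImp (\<lambda>\<eta>. LabL T (At t \<eta>)) Ps S \<Longrightarrow> mtl_rule Ps S"
| ext_box: "box_rule LabL LBox ERel ext_fv Ps S \<Longrightarrow> mtl_rule Ps S"
| int_box: "box_rule (\<lambda>t \<eta>. LabL T (At t \<eta>)) TBox (LabR T) int_fv Ps S \<Longrightarrow> mtl_rule Ps S"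

text \<open>
  The inductive definition admits infinitely many premises and yields exactly the sequents that
  have a well-founded derivation tree.
\<close>

inductive provable :: "fm sequent \<Rightarrow> bool" where
  "mtl_rule Ps S \<Longrightarrow> (\<And>P. P \<in> Ps \<Longrightarrow> provable P) \<Longrightarrow> provable S"

end

theory Submission
  imports Defs "HOL-Library.Multiset" "HOL-Library.Countable"
begin

text \<open>
  Henkin's argument. If a sequent is unprovable, enumerate all formulas and decide them one by one
  with cut, keeping the sequent unprovable; whenever an existential formula or an infinitary
  disjunction enters on the left, or a universal or temporal formula on the right, the
  corresponding rule supplies an instance with a fresh variable (or a suitable disjunct) that may
  be added too. Since each step adds finitely many formulas, fresh variables never run out. The
  formulas collected on the left form a set \<open>G\<close> closed under all rules. The external terms modulo
  the equations in \<open>G\<close> form the base of a structure, and for each external term \<open>T\<close> the internal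
  terms modulo the equations labelled \<open>T\<close> form its node; the label axioms make the node depend
  only on the class of \<open>T\<close>. The formulas true in this structure are exactly those in \<open>G\<close>. As there
  are only countably many terms, it can be realised inside any two infinite types.
\<close>

section \<open>Structural rules\<close>

text \<open>Exchange swaps neighbours only, so \<open>A\<close> travels past \<open>xs\<close> one
  entry at a time. The prefix \<Gamma> is generalised because every entry passed joins it.\<close>

lemma provable_moveL: "provable (\<Gamma> @ A # xs @ ys \<turnstile> \<Delta>) \<Longrightarrow> provable (\<Gamma> @ xs @ A # ys \<turnstile> \<Delta>)"
proof (induction xs arbitrary: \<Gamma>)
  case (Cons x xs)
  have "provable (\<Gamma> @ [x, A] @ (xs @ ys) \<turnstile> \<Delta>)"
    by (rule provable.intros[OF mtl_rule.exchangeL]) (use Cons.prems in simp)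
  then show ?case using Cons.IH[of "\<Gamma> @ [x]"] by simp
qed simp

text \<open>The head of \<open>xs\<close> occurs somewhere in \<open>ys\<close>. The remaining
  entries are permuted with that head absorbed into the prefix, and \<open>provable_moveL\<close>
  then carries it to its place.\<close>

lemma provable_permL: "mset xs = mset ys \<Longrightarrow> provable (\<Gamma> @ xs \<turnstile> \<Delta>) \<Longrightarrow> provable (\<Gamma> @ ys \<turnstile> \<Delta>)"
proof (induction xs arbitrary: \<Gamma> ys)
  case (Cons x xs)
  then have "x \<in> set ys" by (metis list.set_intros(1) set_mset_mset)
  then obtain us vs where ys: "ys = us @ x # vs" by (meson split_list)
  with Cons.prems(1) have "mset xs = mset (us @ vs)" by simp
  then have "provable (\<Gamma> @ x # us @ vs \<turnstile> \<Delta>)"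
    using Cons.IH[of "us @ vs" "\<Gamma> @ [x]"] Cons.prems(2) by simp
  then show ?case unfolding ys by (rule provable_moveL)
qed simp

lemma provable_moveR: "provable (\<Gamma> \<turnstile> \<Delta> @ A # xs @ ys) \<Longrightarrow> provable (\<Gamma> \<turnstile> \<Delta> @ xs @ A # ys)"
proof (induction xs arbitrary: \<Delta>)
  case (Cons x xs)
  have "provable (\<Gamma> \<turnstile> \<Delta> @ [x, A] @ (xs @ ys))"
    by (rule provable.intros[OF mtl_rule.exchangeR]) (use Cons.prems in simp)
  then show ?case using Cons.IH[of "\<Delta> @ [x]"] by simp
qed simp

lemma provable_permR: "mset xs = mset ys \<Longrightarrow> provable (\<Gamma> \<turnstile> \<Delta> @ xs) \<Longrightarrow> provable (\<Gamma> \<turnstile> \<Delta> @ ys)"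
proof (induction xs arbitrary: \<Delta> ys)
  case (Cons x xs)
  then have "x \<in> set ys" by (metis list.set_intros(1) set_mset_mset)
  then obtain us vs where ys: "ys = us @ x # vs" by (meson split_list)
  with Cons.prems(1) have "mset xs = mset (us @ vs)" by simp
  then have "provable (\<Gamma> \<turnstile> \<Delta> @ x # us @ vs)"
    using Cons.IH[of "us @ vs" "\<Delta> @ [x]"] Cons.prems(2) by simp
  then show ?case unfolding ys by (rule provable_moveR)
qed simp

lemma provable_weakenL: "provable (\<Gamma> \<turnstile> \<Delta>) \<Longrightarrow> provable (\<Gamma> @ \<Gamma>' \<turnstile> \<Delta>)"
proof (induction \<Gamma>' rule: rev_induct)
  case (snoc A \<Gamma>')
  have "provable ((\<Gamma> @ \<Gamma>') @ [A] \<turnstile> \<Delta>)"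
    by (rule provable.intros[OF mtl_rule.weakenL]) (use snoc in simp)
  then show ?case by simp
qed simp

lemma provable_weakenR: "provable (\<Gamma> \<turnstile> \<Delta>) \<Longrightarrow> provable (\<Gamma> \<turnstile> \<Delta>' @ \<Delta>)"
proof (induction \<Delta>')
  case (Cons A \<Delta>')
  show ?case unfolding append_Cons
    by (rule provable.intros[OF mtl_rule.weakenR]) (use Cons in simp)
qed simp

text \<open>The contraction rule merges two copies at the end of the antecedent. Permutation brings
  the last entry of \<Gamma>' together with its copy in \<Gamma>, so \<Gamma>' can be shed from its
  end.\<close>

lemma provable_contractL:
  "provable (\<Gamma> @ \<Gamma>' \<turnstile> \<Delta>) \<Longrightarrow> set \<Gamma>' \<subseteq> set \<Gamma> \<Longrightarrow> provable (\<Gamma> \<turnstile> \<Delta>)"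
proof (induction \<Gamma>' rule: rev_induct)
  case (snoc A \<Gamma>')
  then obtain us vs where \<Gamma>: "\<Gamma> = us @ A # vs" by (auto dest: split_list)
  have "provable ((us @ vs @ \<Gamma>') @ [A, A] \<turnstile> \<Delta>)"
    using provable_permL[of "\<Gamma> @ \<Gamma>' @ [A]" "(us @ vs @ \<Gamma>') @ [A, A]" "[]"] snoc.prems(1)
    by (simp add: \<Gamma>)
  then have "provable ((us @ vs @ \<Gamma>') @ [A] \<turnstile> \<Delta>)"
    by (intro provable.intros[OF mtl_rule.contractL]) simp
  then have "provable (\<Gamma> @ \<Gamma>' \<turnstile> \<Delta>)"
    using provable_permL[of "(us @ vs @ \<Gamma>') @ [A]" "\<Gamma> @ \<Gamma>'" "[]"] by (simp add: \<Gamma>)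
  then show ?case using snoc.IH snoc.prems(2) by simp
qed simp

lemma provable_contractR:
  "provable (\<Gamma> \<turnstile> \<Delta>' @ \<Delta>) \<Longrightarrow> set \<Delta>' \<subseteq> set \<Delta> \<Longrightarrow> provable (\<Gamma> \<turnstile> \<Delta>)"
proof (induction \<Delta>')
  case (Cons A \<Delta>')
  then obtain us vs where \<Delta>: "\<Delta> = us @ A # vs" by (auto dest: split_list)
  have "provable (\<Gamma> \<turnstile> A # A # \<Delta>' @ us @ vs)"
    using provable_permR[of "(A # \<Delta>') @ \<Delta>" "A # A # \<Delta>' @ us @ vs" _ "[]"] Cons.prems(1)
    by (simp add: \<Delta>)
  then have "provable (\<Gamma> \<turnstile> A # \<Delta>' @ us @ vs)"
    by (intro provable.intros[OF mtl_rule.contractR]) simp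
  then have "provable (\<Gamma> \<turnstile> \<Delta>' @ \<Delta>)"
    using provable_permR[of "A # \<Delta>' @ us @ vs" "\<Delta>' @ \<Delta>" _ "[]"] by (simp add: \<Delta>)
  then show ?case using Cons.IH Cons.prems(2) by simp
qed simp

text \<open>Weakening joins the old and the new lists, and contraction removes the old ones. From
  here on a sequent can be treated as a pair of finite sets.\<close>

lemma provable_mono:
  assumes "provable (\<Gamma> \<turnstile> \<Delta>)" "set \<Gamma> \<subseteq> set \<Gamma>'" "set \<Delta> \<subseteq> set \<Delta>'"
  shows "provable (\<Gamma>' \<turnstile> \<Delta>')"
proof -
  have "provable (\<Gamma> @ \<Gamma>' \<turnstile> \<Delta>' @ \<Delta>)" using assms(1) by (intro provable_weakenL provable_weakenR)
  then have "provable (\<Gamma>' @ \<Gamma> \<turnstile> \<Delta> @ \<Delta>')"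
    using provable_permL[of "\<Gamma> @ \<Gamma>'" "\<Gamma>' @ \<Gamma>" "[]"] provable_permR[of "\<Delta>' @ \<Delta>" "\<Delta> @ \<Delta>'" _ "[]"]
    by (simp add: union_commute)
  then show ?thesis using assms by (blast intro: provable_contractL provable_contractR)
qed


section \<open>Countability and freshness\<close>

instance ivar :: countable by countable_datatype
instance evar :: countable by countable_datatype
instance tm :: (countable) countable by countable_datatype
instance fo :: (countable) countable by countable_datatype
instance rfm :: (countable) countable by countable_datatype
instance interval :: countable
  \<comment> \<open>\<open>interval\<close> is a typedef rather than a datatype, so it inherits
    countability from the representing triples.\<close>
  by (rule countable_classI[of "\<lambda>I. to_nat (Rep_interval I)"]) (simp add: Rep_interval_inject)
instance tfm :: countable by countable_datatype
instance lfm :: countable by countable_datatype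
instance fm :: countable by countable_datatype

lemma infinite_evar: "infinite (UNIV :: evar set)"
  by (metis evar.inject finite_subset infinite_UNIV_nat finite_imageD injI subset_UNIV)

lemma infinite_ivar: "infinite (UNIV :: ivar set)"
  by (metis ivar.inject finite_subset infinite_UNIV_nat finite_imageD injI subset_UNIV)

lemma finite_tm_vars: "finite (tm_vars t)"
  by (induction t) auto

lemma finite_fo_fv: "finite (fo_fv \<phi>)"
  by (induction \<phi>) (auto simp: finite_tm_vars)

lemma finite_rfm_fv: "finite (rfm_fv \<rho>)"
  by (cases \<rho>) (auto simp: finite_tm_vars finite_fo_fv)

lemma finite_lfm_fv: "finite (lfm_fv \<alpha>)"
  by (induction \<alpha>) (auto simp: finite_tm_vars)

lemma finite_ext_fv: "finite (ext_fv A)"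
  by (cases A) (auto simp: finite_tm_vars finite_rfm_fv)

lemma finite_int_fv: "finite (int_fv A)"
  by (cases A) (auto simp: finite_lfm_fv finite_rfm_fv)

text \<open>Only a bound variable of \<phi> can capture, so all but finitely many variables are safe
  to substitute.\<close>

lemma finite_not_free_for: "finite {y. \<not> free_for x (Var y) \<phi>}"
proof (induction \<phi>)
  case (Conj \<phi> \<psi>)
  then show ?case
    by (auto intro: finite_subset[of _ "{y. \<not> free_for x (Var y) \<phi>} \<union> {y. \<not> free_for x (Var y) \<psi>}"])
next
  case (Disj \<phi> \<psi>)
  then show ?case
    by (auto intro: finite_subset[of _ "{y. \<not> free_for x (Var y) \<phi>} \<union> {y. \<not> free_for x (Var y) \<psi>}"])
next
  case (Imp \<phi> \<psi>)
  then show ?case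
    by (auto intro: finite_subset[of _ "{y. \<not> free_for x (Var y) \<phi>} \<union> {y. \<not> free_for x (Var y) \<psi>}"])
next
  case (Forall z \<phi>)
  then show ?case by (auto intro: finite_subset[of _ "insert z {y. \<not> free_for x (Var y) \<phi>}"])
next
  case (Exists z \<phi>)
  then show ?case by (auto intro: finite_subset[of _ "insert z {y. \<not> free_for x (Var y) \<phi>}"])
qed auto

lemma tm_subst_idle: "x \<notin> tm_vars t \<Longrightarrow> tm_subst x s t = t"
  by (induction t) auto

lemma size_tm_subst: "size (tm_subst x (Var y) t) = size t"
  by (induction t) auto

text \<open>An instance of a quantified formula is not a subterm of it. Equality of sizes is what
  lets \<open>fo_truth\<close> proceed by induction on size.\<close>

lemma size_fo_subst: "size (fo_subst x (Var y) \<phi>) = size \<phi>"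
  by (induction \<phi>) (auto simp: size_tm_subst)


section \<open>Saturated sets\<close>

text \<open>\<open>B\<close> holds names that the witness has to avoid; \<open>named\<close>
  exploits this freedom to find variables that are not captured. The embedding \<open>E\<close>
  makes one definition serve external and labelled formulas.\<close>

fun wit_left :: "('v rfm \<Rightarrow> fm) \<Rightarrow> 'v set \<Rightarrow> fm set \<Rightarrow> 'v rfm \<Rightarrow> bool" where
  "wit_left E B G (FO (Exists x \<phi>)) \<longleftrightarrow>
     (\<exists>y. y \<notin> B \<and> free_for x (Var y) \<phi> \<and> E (FO (fo_subst x (Var y) \<phi>)) \<in> G)"
| "wit_left E B G (InfOr t) \<longleftrightarrow> (\<exists>n. E (FO (Less t ((Fn ^^ n) Cst))) \<in> G)"
| "wit_left E B G _ \<longleftrightarrow> True"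

fun wit_right :: "('v rfm \<Rightarrow> fm) \<Rightarrow> fm set \<Rightarrow> 'v rfm \<Rightarrow> bool" where
  "wit_right E D (FO (Forall x \<phi>)) \<longleftrightarrow>
     (\<exists>y. free_for x (Var y) \<phi> \<and> E (FO (fo_subst x (Var y) \<phi>)) \<in> D)"
| "wit_right E D _ \<longleftrightarrow> True"

text \<open>A counterexample to a box: a variable that is asserted to lie in the interval while the
  body is rejected there. \<open>D\<close> stands for the formulas on the right.\<close>

definition wit_box ::
  "('v tm \<Rightarrow> 'f \<Rightarrow> fm) \<Rightarrow> ('v rfm \<Rightarrow> fm) \<Rightarrow> fm set \<Rightarrow> fm set \<Rightarrow> interval \<Rightarrow> 'v tm \<Rightarrow> 'f \<Rightarrow> bool" where
  "wit_box L E G D I t \<alpha> \<longleftrightarrow>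
     (\<exists>x. (\<forall>\<phi>\<in>set (bounds I t (Var x)). E (FO \<phi>) \<in> G) \<and> L (Var x) \<alpha> \<in> D)"

fun witness_left :: "evar set \<Rightarrow> ivar set \<Rightarrow> fm set \<Rightarrow> fm \<Rightarrow> bool" where
  "witness_left B C G (ERel \<rho>) \<longleftrightarrow> wit_left ERel B G \<rho>"
| "witness_left B C G (LabR T \<rho>) \<longleftrightarrow> wit_left (LabR T) C G \<rho>"
| "witness_left B C G (LabL T \<alpha>) \<longleftrightarrow> True"

fun witness_right :: "fm set \<Rightarrow> fm set \<Rightarrow> fm \<Rightarrow> bool" where
  "witness_right G D (ERel \<rho>) \<longleftrightarrow> wit_right ERel D \<rho>"
| "witness_right G D (LabR T \<rho>) \<longleftrightarrow> wit_right (LabR T) D \<rho>"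
| "witness_right G D (LabL T (LBox I \<alpha>)) \<longleftrightarrow> wit_box LabL ERel G D I T \<alpha>"
| "witness_right G D (LabL T (At t (TBox I \<psi>))) \<longleftrightarrow>
     wit_box (\<lambda>t \<eta>. LabL T (At t \<eta>)) (LabR T) G D I t \<psi>"
| "witness_right G D _ \<longleftrightarrow> True"

section \<open>Monotonicity of witnesses and one-step extensions of unprovable sequents\<close>

lemma wit_left_mono: "wit_left E B G \<rho> \<Longrightarrow> G \<subseteq> G' \<Longrightarrow> wit_left E B G' \<rho>"
  by (induction E B G \<rho> rule: wit_left.induct) auto

lemma wit_right_mono: "wit_right E D \<rho> \<Longrightarrow> D \<subseteq> D' \<Longrightarrow> wit_right E D' \<rho>"
  by (induction E D \<rho> rule: wit_right.induct) auto

lemma witness_left_mono: "witness_left B C G A \<Longrightarrow> G \<subseteq> G' \<Longrightarrow> witness_left B C G' A"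
  by (cases A) (auto intro: wit_left_mono)

lemma witness_right_mono:
  "witness_right G D A \<Longrightarrow> G \<subseteq> G' \<Longrightarrow> D \<subseteq> D' \<Longrightarrow> witness_right G' D' A"
  by (induction G D A rule: witness_right.induct) (auto simp: wit_box_def intro: wit_right_mono)

text \<open>Every rule read backwards. As the conclusion only has to be contained in the unprovable
  sequent, the principal formula may already belong to \<Gamma> or \<Delta> and is kept in the
  premise.\<close>

lemma unprovable_premise:
  assumes "\<not> provable (\<Gamma> \<turnstile> \<Delta>)" "mtl_rule Ps (\<Gamma>' \<turnstile> \<Delta>')" "set \<Gamma>' \<subseteq> set \<Gamma>" "set \<Delta>' \<subseteq> set \<Delta>"
  shows "\<exists>P\<in>Ps. \<not> provable P"
  using assms provable.intros provable_mono by blast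

text \<open>If all instances of a disjunction \<open>InfOr t\<close> led to provable sequents, the
  infinitary rule would prove the given one, so some disjunct can be added. For an existential
  formula the eigenvariable rule plays this role.\<close>

lemma extend_left:
  fixes E :: "'v rfm \<Rightarrow> fm"
  assumes np: "\<not> provable (\<Gamma> \<turnstile> \<Delta>)" and A: "E \<rho> \<in> set \<Gamma>" and "finite B"
    and rule: "\<And>Ps S. rel_rule E fv Ps S \<Longrightarrow> mtl_rule Ps S"
    and inf: "infinite (UNIV :: 'v set)" and fin: "\<And>A. finite (fv A)"
  shows "\<exists>\<Gamma>'. \<not> provable (\<Gamma>' \<turnstile> \<Delta>) \<and> set \<Gamma> \<subseteq> set \<Gamma>' \<and> wit_left E B (set \<Gamma>') \<rho>"
proof -
  consider x \<phi> where "\<rho> = FO (Exists x \<phi>)" | t where "\<rho> = InfOr t" | "\<And>G. wit_left E B G \<rho>"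
    by (cases "(E, B, {} :: fm set, \<rho>)" rule: wit_left.cases) auto
  then show ?thesis
  proof cases
    case (1 x \<phi>)
    \<comment> \<open>The excluded variables are the names in \<open>B\<close>, those that would be
      captured, and those ruled out by the eigenvariable condition.\<close>
    have "finite (B \<union> {y. \<not> free_for x (Var y) \<phi>} \<union> fo_fv (Exists x \<phi>) \<union> (\<Union>A\<in>set (\<Gamma> @ \<Delta>). fv A))"
      using \<open>finite B\<close> finite_not_free_for[of x \<phi>] fin finite_fo_fv[of "Exists x \<phi>"] by (simp del: fo_fv.simps)
    from ex_new_if_finite[OF inf this] obtain y where y: "y \<notin> B" "free_for x (Var y) \<phi>"
      "y \<notin> fo_fv (Exists x \<phi>)" "y \<notin> (\<Union>A\<in>set (\<Gamma> @ \<Delta>). fv A)" by blast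
    have "\<not> provable (\<Gamma> @ [E (FO (fo_subst x (Var y) \<phi>))] \<turnstile> \<Delta>)"
      using unprovable_premise[OF np rule[OF rel_rule.existsL[OF y(2-4)]]] A 1 by auto
    with 1 y show ?thesis by (intro exI[of _ "\<Gamma> @ [E (FO (fo_subst x (Var y) \<phi>))]"]) auto
  next
    case (2 t)
    then obtain n where "\<not> provable (\<Gamma> @ [E (FO (Less t ((Fn ^^ n) Cst)))] \<turnstile> \<Delta>)"
      using unprovable_premise[OF np rule[OF rel_rule.infOrL[of E fv \<Gamma> t \<Delta>]]] A by auto
    with 2 show ?thesis by (intro exI[of _ "\<Gamma> @ [E (FO (Less t ((Fn ^^ n) Cst)))]"]) auto
  next
    case 3
    with np show ?thesis by blast
  qed
qed

lemma extend_right: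
  fixes E :: "'v rfm \<Rightarrow> fm"
  assumes np: "\<not> provable (\<Gamma> \<turnstile> \<Delta>)" and A: "E \<rho> \<in> set \<Delta>"
    and rule: "\<And>Ps S. rel_rule E fv Ps S \<Longrightarrow> mtl_rule Ps S"
    and inf: "infinite (UNIV :: 'v set)" and fin: "\<And>A. finite (fv A)"
  shows "\<exists>\<Delta>'. \<not> provable (\<Gamma> \<turnstile> \<Delta>') \<and> set \<Delta> \<subseteq> set \<Delta>' \<and> wit_right E (set \<Delta>') \<rho>"
proof -
  consider x \<phi> where "\<rho> = FO (Forall x \<phi>)" | "\<And>G. wit_right E G \<rho>"
    by (cases "(E, {} :: fm set, \<rho>)" rule: wit_right.cases) auto
  then show ?thesis
  proof cases
    case (1 x \<phi>)
    have "finite ({y. \<not> free_for x (Var y) \<phi>} \<union> fo_fv (Forall x \<phi>) \<union> (\<Union>A\<in>set (\<Gamma> @ \<Delta>). fv A))"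
      using finite_not_free_for[of x \<phi>] fin finite_fo_fv[of "Forall x \<phi>"] by (simp del: fo_fv.simps)
    from ex_new_if_finite[OF inf this] obtain y where y: "free_for x (Var y) \<phi>"
      "y \<notin> fo_fv (Forall x \<phi>)" "y \<notin> (\<Union>A\<in>set (\<Gamma> @ \<Delta>). fv A)" by blast
    have "\<not> provable (\<Gamma> \<turnstile> E (FO (fo_subst x (Var y) \<phi>)) # \<Delta>)"
      using unprovable_premise[OF np rule[OF rel_rule.forallR[OF y]]] A 1 by auto
    with 1 y show ?thesis by (intro exI[of _ "E (FO (fo_subst x (Var y) \<phi>)) # \<Delta>"]) auto
  next
    case 2
    with np show ?thesis by blast
  qed
qed

lemma extend_box:
  fixes E :: "'v rfm \<Rightarrow> fm"
  assumes np: "\<not> provable (\<Gamma> \<turnstile> \<Delta>)" and A: "L t (box I \<alpha>) \<in> set \<Delta>"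
    and rule: "\<And>Ps S. box_rule L box E fv Ps S \<Longrightarrow> mtl_rule Ps S"
    and inf: "infinite (UNIV :: 'v set)" and fin: "\<And>A. finite (fv A)"
  shows "\<exists>\<Gamma>' \<Delta>'. \<not> provable (\<Gamma>' \<turnstile> \<Delta>') \<and> set \<Gamma> \<subseteq> set \<Gamma>' \<and> set \<Delta> \<subseteq> set \<Delta>' \<and>
    wit_box L E (set \<Gamma>') (set \<Delta>') I t \<alpha>"
proof -
  have "finite ((\<Union>A\<in>set (\<Gamma> @ \<Delta>). fv A) \<union> tm_vars t)"
    using fin finite_tm_vars by blast
  from ex_new_if_finite[OF inf this] obtain x where
    x: "x \<notin> (\<Union>A\<in>set (\<Gamma> @ \<Delta>). fv A) \<union> tm_vars t" by blast
  have "\<not> provable (\<Gamma> @ map (\<lambda>\<phi>. E (FO \<phi>)) (bounds I t (Var x)) \<turnstile> L (Var x) \<alpha> # \<Delta>)"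
    using unprovable_premise[OF np rule[OF box_rule.boxR[OF x, of L box E I \<alpha>]]] A by auto
  then show ?thesis unfolding wit_box_def
    by (intro exI[of _ "\<Gamma> @ map (\<lambda>\<phi>. E (FO \<phi>)) (bounds I t (Var x))"]
        exI[of _ "L (Var x) \<alpha> # \<Delta>"] conjI exI[of _ x]) auto
qed

lemma extend:
  assumes "\<not> provable (\<Gamma> \<turnstile> \<Delta>)" "finite B" "finite C"
  shows "\<exists>\<Gamma>' \<Delta>'. \<not> provable (\<Gamma>' \<turnstile> \<Delta>') \<and> set \<Gamma> \<subseteq> set \<Gamma>' \<and> set \<Delta> \<subseteq> set \<Delta>' \<and>
    (A \<in> set \<Gamma>' \<and> witness_left B C (set \<Gamma>') A \<or> A \<in> set \<Delta>' \<and> witness_right (set \<Gamma>') (set \<Delta>') A)"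
proof -
  \<comment> \<open>By cut, \<open>A\<close> can be put on at least one side; the rest of the proof
    adds the witness which that side demands.\<close>
  have "\<not> provable (\<Gamma> @ [A] \<turnstile> \<Delta>) \<or> \<not> provable (\<Gamma> \<turnstile> A # \<Delta>)"
    using unprovable_premise[OF assms(1) mtl_rule.cut[of \<Gamma> A \<Delta>]] by auto
  then show ?thesis
  proof
    assume np: "\<not> provable (\<Gamma> @ [A] \<turnstile> \<Delta>)"
    have "\<exists>\<Gamma>'. \<not> provable (\<Gamma>' \<turnstile> \<Delta>) \<and> set (\<Gamma> @ [A]) \<subseteq> set \<Gamma>' \<and> witness_left B C (set \<Gamma>') A"
    proof (cases A)
      case (ERel \<rho>)
      then show ?thesis
        using extend_left[OF np, of ERel \<rho> B ext_fv] assms(2) mtl_rule.ext_rel infinite_evar finite_ext_fv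
        by auto
    next
      case (LabR T \<rho>)
      then show ?thesis
        using extend_left[OF np, of "LabR T" \<rho> C int_fv] assms(3) mtl_rule.int_rel infinite_ivar finite_int_fv
        by auto
    next
      case (LabL T \<alpha>)
      with np show ?thesis by auto
    qed
    then show ?thesis by auto
  next
    assume np: "\<not> provable (\<Gamma> \<turnstile> A # \<Delta>)"
    have "\<exists>\<Gamma>' \<Delta>'. \<not> provable (\<Gamma>' \<turnstile> \<Delta>') \<and> set \<Gamma> \<subseteq> set \<Gamma>' \<and> set (A # \<Delta>) \<subseteq> set \<Delta>' \<and>
      witness_right (set \<Gamma>') (set \<Delta>') A"
    proof (cases "({} :: fm set, {} :: fm set, A)" rule: witness_right.cases)
      case (1 G D \<rho>)
      then show ?thesis
        using extend_right[OF np, of ERel \<rho> ext_fv] mtl_rule.ext_rel infinite_evar finite_ext_fv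
        by auto
    next
      case (2 G D T \<rho>)
      then show ?thesis
        using extend_right[OF np, of "LabR T" \<rho> int_fv] mtl_rule.int_rel infinite_ivar finite_int_fv
        by auto
    next
      case (3 G D T I \<alpha>)
      then show ?thesis
        using extend_box[OF np, of LabL T LBox I \<alpha> ERel ext_fv] mtl_rule.ext_box infinite_evar finite_ext_fv
        by auto
    next
      case (4 G D T t I \<psi>)
      then show ?thesis
        using extend_box[OF np, of "\<lambda>t \<eta>. LabL T (At t \<eta>)" t TBox I \<psi> "LabR T" int_fv]
          mtl_rule.int_box infinite_ivar finite_int_fv
        by auto
    qed ((rule exI[of _ \<Gamma>], rule exI[of _ "A # \<Delta>"], use np in simp)+)
    then show ?thesis by auto
  qed
qed

text \<open>Deductive closure for sequents with several conclusions: an empty \<Delta> expresses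
  consistency, and a longer one primeness.\<close>

definition closed :: "fm set \<Rightarrow> bool" where
  "closed G \<longleftrightarrow> (\<forall>\<Gamma> \<Delta>. provable (\<Gamma> \<turnstile> \<Delta>) \<longrightarrow> set \<Gamma> \<subseteq> G \<longrightarrow> (\<exists>B\<in>set \<Delta>. B \<in> G))"

text \<open>The complement of \<open>G\<close> takes the place of the right-hand side. Since
  \<open>B\<close> and \<open>C\<close> range over all finite sets, an existential formula in
  \<open>G\<close> has witnesses outside any finite set of names.\<close>

definition saturated :: "fm set \<Rightarrow> bool" where
  "saturated G \<longleftrightarrow>
     closed G \<and>
     (\<forall>A B C. A \<in> G \<longrightarrow> finite B \<longrightarrow> finite C \<longrightarrow> witness_left B C G A) \<and>
     (\<forall>A. A \<notin> G \<longrightarrow> witness_right G (- G) A)"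

text \<open>The bound holds for all later stages as well, so that the stages found for two finite
  sets can be merged by taking their maximum.\<close>

lemma incseq_subset_finite:
  fixes S :: "nat \<Rightarrow> 'a set"
  assumes "\<And>n. S n \<subseteq> S (Suc n)" "finite F" "F \<subseteq> (\<Union>n. S n)"
  shows "\<exists>n. \<forall>m\<ge>n. F \<subseteq> S m"
proof -
  have mono: "S n \<subseteq> S m" if "n \<le> m" for n m using lift_Suc_mono_le[of S, OF assms(1) that] .
  show ?thesis using assms(2,3)
  proof (induction F rule: finite_induct)
    case (insert a F)
    then obtain n k where "\<forall>m\<ge>n. F \<subseteq> S m" "a \<in> S k" by auto
    then show ?case using mono by (intro exI[of _ "max n k"]) (auto; blast)
  qed auto
qed

text \<open>
  Every formula is treated infinitely often, each time with its witnesses avoiding other finite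
  sets of variables; this provides every term with names that avoid any given bound variables.
\<close>

lemma saturated_extension:
  assumes "\<not> provable (\<Gamma> \<turnstile> \<Delta>)"
  shows "\<exists>G. saturated G \<and> set \<Gamma> \<subseteq> G \<and> set \<Delta> \<inter> G = {}"
proof -
  \<comment> \<open>The finite sets to be avoided are coded by lists, so the triples form a
    countable type and can be enumerated by \<open>from_nat\<close>.\<close>
  let ?treated = "\<lambda>(A, bs, cs) \<Gamma> \<Delta>. A \<in> set \<Gamma> \<and> witness_left (set bs) (set cs) (set \<Gamma>) A \<or>
    A \<in> set \<Delta> \<and> witness_right (set \<Gamma>) (set \<Delta>) A"
  \<comment> \<open>Dependent choice builds the stages: stage 0 is the given sequent, and the
    passage from stage \<open>n\<close> to \<open>Suc n\<close> treats the \<open>n\<close>-th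
    triple.\<close>
  have "\<exists>f. \<forall>n. (\<not> provable (fst (f n) \<turnstile> snd (f n)) \<and> (n = 0 \<longrightarrow> f n = (\<Gamma>, \<Delta>))) \<and>
    (set (fst (f n)) \<subseteq> set (fst (f (Suc n))) \<and> set (snd (f n)) \<subseteq> set (snd (f (Suc n))) \<and>
     ?treated (from_nat n) (fst (f (Suc n))) (snd (f (Suc n))))"
  proof (rule dependent_nat_choice)
    show "\<exists>p. \<not> provable (fst p \<turnstile> snd p) \<and> (0 = (0::nat) \<longrightarrow> p = (\<Gamma>, \<Delta>))"
      using assms by auto
  next
    fix p :: "fm list \<times> fm list" and n :: nat
    assume p: "\<not> provable (fst p \<turnstile> snd p) \<and> (n = 0 \<longrightarrow> p = (\<Gamma>, \<Delta>))"
    obtain A bs cs where [simp]: "from_nat n = (A :: fm, bs :: evar list, cs :: ivar list)"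
      by (cases "from_nat n :: fm \<times> evar list \<times> ivar list") auto
    show "\<exists>q. (\<not> provable (fst q \<turnstile> snd q) \<and> (Suc n = 0 \<longrightarrow> q = (\<Gamma>, \<Delta>))) \<and>
      (set (fst p) \<subseteq> set (fst q) \<and> set (snd p) \<subseteq> set (snd q) \<and>
       ?treated (from_nat n) (fst q) (snd q))"
      using extend[of "fst p" "snd p" "set bs" "set cs" A] p by auto
  qed
  then obtain f where f:
    "\<And>n. \<not> provable (fst (f n) \<turnstile> snd (f n))" "f 0 = (\<Gamma>, \<Delta>)"
    "\<And>n. set (fst (f n)) \<subseteq> set (fst (f (Suc n)))" "\<And>n. set (snd (f n)) \<subseteq> set (snd (f (Suc n)))"
    "\<And>n. ?treated (from_nat n) (fst (f (Suc n))) (snd (f (Suc n)))"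
    by blast
  define G where "G = (\<Union>n. set (fst (f n)))"
  define D where "D = (\<Union>n. set (snd (f n)))"
  \<comment> \<open>A proof has only finitely many formulas in its end sequent, so they all occur in
    a single stage, which is unprovable.\<close>
  have con: "\<not> provable (\<Gamma>' \<turnstile> \<Delta>')" if sub: "set \<Gamma>' \<subseteq> G" "set \<Delta>' \<subseteq> D" for \<Gamma>' \<Delta>'
  proof
    assume pr: "provable (\<Gamma>' \<turnstile> \<Delta>')"
    obtain n where n: "\<And>m. m \<ge> n \<Longrightarrow> set \<Gamma>' \<subseteq> set (fst (f m))"
      using incseq_subset_finite[of "\<lambda>n. set (fst (f n))" "set \<Gamma>'"] f(3) sub by (auto simp: G_def)
    obtain k where k: "\<And>m. m \<ge> k \<Longrightarrow> set \<Delta>' \<subseteq> set (snd (f m))"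
      using incseq_subset_finite[of "\<lambda>n. set (snd (f n))" "set \<Delta>'"] f(4) sub by (auto simp: D_def)
    show False using f(1)[of "max n k"] provable_mono[OF pr n k, of "max n k" "max n k"] by simp
  qed
  have disj: "G \<inter> D = {}"
  proof (rule ccontr)
    assume "G \<inter> D \<noteq> {}"
    then obtain A where "A \<in> G" "A \<in> D" by blast
    with con[of "[A]" "[A]"] provable.intros[OF mtl_rule.identity[of A]] show False by auto
  qed
  \<comment> \<open>Each triple is treated at the step given by its code, and the witnesses found
    there survive in the union by monotonicity.\<close>
  have treated: "A \<in> G \<and> witness_left (set bs) (set cs) G A \<or> A \<in> D \<and> witness_right G D A" for A bs cs
  proof -
    have "set (fst (f (Suc n))) \<subseteq> G" "set (snd (f (Suc n))) \<subseteq> D" for n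
      unfolding G_def D_def by blast+
    then show ?thesis
      using f(5)[of "to_nat (A, bs, cs)"] witness_left_mono witness_right_mono by (auto; blast)
  qed
  then have D: "D = - G" using disj by blast
  have "saturated G" unfolding saturated_def closed_def
  proof (intro conjI allI impI)
    fix \<Gamma>' \<Delta>' assume "provable (\<Gamma>' \<turnstile> \<Delta>')" "set \<Gamma>' \<subseteq> G"
    with con show "\<exists>B\<in>set \<Delta>'. B \<in> G" unfolding D by blast
  next
    fix A and B :: "evar set" and C :: "ivar set"
    assume "A \<in> G" "finite B" "finite C"
    then show "witness_left B C G A"
      using treated[of A] disj by (metis disjoint_iff finite_list)
  next
    fix A assume "A \<notin> G"
    then show "witness_right G (- G) A" using treated[of A] D by auto
  qed
  moreover have "set \<Gamma> \<subseteq> G" "set \<Delta> \<subseteq> D"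
    unfolding G_def D_def using f(2) by (metis UN_upper UNIV_I fst_conv snd_conv)+
  ultimately show ?thesis using disj by blast
qed


section \<open>Closure under the propositional rules\<close>

lemma closedD: "closed G \<Longrightarrow> provable (\<Gamma> \<turnstile> \<Delta>) \<Longrightarrow> set \<Gamma> \<subseteq> G \<Longrightarrow> \<exists>B\<in>set \<Delta>. B \<in> G"
  unfolding closed_def by blast

lemma provable_common: "A \<in> set \<Gamma> \<Longrightarrow> A \<in> set \<Delta> \<Longrightarrow> provable (\<Gamma> \<turnstile> \<Delta>)"
  by (rule provable_mono[OF provable.intros[OF mtl_rule.identity[of A]]]) auto

text \<open>Each direction comes from a sequent obtained by one rule from identities. Stating the
  rules as an inclusion of relations covers relational, labelled and doubly labelled formulas at
  once.\<close>

lemma closed_prop: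
  assumes G: "closed G" and rule: "prop_rule neg cnj dsj imp E \<le> mtl_rule"
  shows "E (neg \<phi>) \<in> G \<longleftrightarrow> E \<phi> \<notin> G"
    and "E (cnj \<phi> \<psi>) \<in> G \<longleftrightarrow> E \<phi> \<in> G \<and> E \<psi> \<in> G"
    and "E (dsj \<phi> \<psi>) \<in> G \<longleftrightarrow> E \<phi> \<in> G \<or> E \<psi> \<in> G"
    and "E (imp \<phi> \<psi>) \<in> G \<longleftrightarrow> (E \<phi> \<in> G \<longrightarrow> E \<psi> \<in> G)"
proof -
  note pr = provable.intros[OF predicate2D[OF rule]]
  have "provable ([E \<phi>] @ [E (neg \<phi>)] \<turnstile> [])"
    by (rule pr[OF prop_rule.negL]) (auto intro: provable_common)
  moreover have "provable ([] \<turnstile> E (neg \<phi>) # [E \<phi>])"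
    by (rule pr[OF prop_rule.negR]) (auto intro: provable_common)
  ultimately show "E (neg \<phi>) \<in> G \<longleftrightarrow> E \<phi> \<notin> G"
    by (fastforce dest!: closedD[OF G])
  have "provable ([] @ [E (cnj \<phi> \<psi>)] \<turnstile> [E \<phi>])" "provable ([] @ [E (cnj \<phi> \<psi>)] \<turnstile> [E \<psi>])"
    by (rule pr[OF prop_rule.conjL]; auto intro: provable_common)+
  moreover have "provable ([E \<phi>, E \<psi>] \<turnstile> E (cnj \<phi> \<psi>) # [])"
    by (rule pr[OF prop_rule.conjR]) (auto intro: provable_common)
  ultimately show "E (cnj \<phi> \<psi>) \<in> G \<longleftrightarrow> E \<phi> \<in> G \<and> E \<psi> \<in> G"
    by (fastforce dest!: closedD[OF G])
  have "provable ([] @ [E (dsj \<phi> \<psi>)] \<turnstile> [E \<phi>, E \<psi>])"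
    by (rule pr[OF prop_rule.disjL]) (auto intro: provable_common)
  moreover have "provable ([E \<phi>] \<turnstile> E (dsj \<phi> \<psi>) # [])" "provable ([E \<psi>] \<turnstile> E (dsj \<phi> \<psi>) # [])"
    by (rule pr[OF prop_rule.disjR]; auto intro: provable_common)+
  ultimately show "E (dsj \<phi> \<psi>) \<in> G \<longleftrightarrow> E \<phi> \<in> G \<or> E \<psi> \<in> G"
    by (fastforce dest!: closedD[OF G])
  have "provable ([E \<phi>] @ [E (imp \<phi> \<psi>)] \<turnstile> [E \<psi>])"
    by (rule pr[OF prop_rule.impL]) (auto intro: provable_common)
  moreover have "provable ([] \<turnstile> E (imp \<phi> \<psi>) # [E \<phi>])" "provable ([E \<psi>] \<turnstile> E (imp \<phi> \<psi>) # [])"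
    by (rule pr[OF prop_rule.impR]; auto intro: provable_common)+
  ultimately show "E (imp \<phi> \<psi>) \<in> G \<longleftrightarrow> (E \<phi> \<in> G \<longrightarrow> E \<psi> \<in> G)"
    by (fastforce dest!: closedD[OF G])
qed

text \<open>From left to right, the premises of \<open>boxL\<close> are identities once the bounds
  and the conclusion are in the context. From right to left, a rejected box would have a witness
  contradicting the right side.\<close>

lemma closed_box:
  assumes G: "closed G" and rule: "box_rule L box E fv \<le> mtl_rule"
    and wit: "L t (box I \<alpha>) \<notin> G \<Longrightarrow> wit_box L E G (- G) I t \<alpha>"
  shows "L t (box I \<alpha>) \<in> G \<longleftrightarrow> (\<forall>s. (\<forall>\<phi>\<in>set (bounds I t s). E (FO \<phi>) \<in> G) \<longrightarrow> L s \<alpha> \<in> G)"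
    (is "?l \<longleftrightarrow> ?r")
proof
  assume ?l
  show ?r
  proof (intro allI impI)
    fix s assume s: "\<forall>\<phi>\<in>set (bounds I t s). E (FO \<phi>) \<in> G"
    let ?\<Gamma> = "map (\<lambda>\<phi>. E (FO \<phi>)) (bounds I t s)"
    have "provable (?\<Gamma> @ [L t (box I \<alpha>)] \<turnstile> [L s \<alpha>])"
      by (rule provable.intros[OF predicate2D[OF rule box_rule.boxL[where s = s]]]) (auto intro!: provable_common)
    with \<open>?l\<close> s show "L s \<alpha> \<in> G" by (fastforce dest!: closedD[OF G])
  qed
next
  assume ?r
  with wit show ?l by (auto simp: wit_box_def)
qed


section \<open>The canonical structure of a relational theory\<close>

lemma tm_val_fun_upd_idle: "x \<notin> tm_vars t \<Longrightarrow> tm_val A (\<sigma>(x := d)) t = tm_val A \<sigma> t"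
  by (induction t) auto

lemma tm_val_subst: "tm_val A \<sigma> (tm_subst x s t) = tm_val A (\<sigma>(x := tm_val A \<sigma> s)) t"
  by (induction t) auto

lemma fo_sat_fun_upd_idle: "x \<notin> fo_fv \<phi> \<Longrightarrow> fo_sat A (\<sigma>(x := d)) \<phi> = fo_sat A \<sigma> \<phi>"
proof (induction \<phi> arbitrary: \<sigma>)
  case (Forall y \<phi>)
  have "fo_sat A (\<sigma>(x := d, y := d')) \<phi> = fo_sat A (\<sigma>(y := d')) \<phi>" for d'
    using Forall by (cases "y = x") (simp, metis fo_fv.simps Diff_iff fun_upd_twist singletonD)
  then show ?case by (simp only: fo_sat.simps)
next
  case (Exists y \<phi>)
  have "fo_sat A (\<sigma>(x := d, y := d')) \<phi> = fo_sat A (\<sigma>(y := d')) \<phi>" for d'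
    using Exists by (cases "y = x") (simp, metis fo_fv.simps Diff_iff fun_upd_twist singletonD)
  then show ?case by (simp only: fo_sat.simps)
qed (auto simp: tm_val_fun_upd_idle)

lemma fo_subst_idle: "x \<notin> fo_fv \<phi> \<Longrightarrow> fo_subst x s \<phi> = \<phi>"
  by (induction \<phi>) (auto simp: tm_subst_idle)

text \<open>Under a quantifier, either the absence of capture lets the two updates of the assignment
  commute, or \<open>x\<close> is not free and neither side depends on it.\<close>

lemma fo_sat_subst:
  "free_for x s \<phi> \<Longrightarrow> fo_sat A \<sigma> (fo_subst x s \<phi>) \<longleftrightarrow> fo_sat A (\<sigma>(x := tm_val A \<sigma> s)) \<phi>"
proof (induction \<phi> arbitrary: \<sigma>)
  case (Forall y \<phi>)
  show ?case
  proof (cases "x \<in> fo_fv (Forall y \<phi>)")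
    case True
    with Forall.prems have x: "y \<noteq> x" "y \<notin> tm_vars s" "free_for x s \<phi>" by auto
    then have "fo_sat A (\<sigma>(y := d)) (fo_subst x s \<phi>) = fo_sat A (\<sigma>(x := tm_val A \<sigma> s, y := d)) \<phi>" for d
      using Forall.IH[of "\<sigma>(y := d)"] by (metis fun_upd_twist tm_val_fun_upd_idle)
    with x show ?thesis by (simp only: fo_sat.simps fo_subst.simps if_False)
  next
    case False
    then show ?thesis
      using fo_subst_idle[OF False] fo_sat_fun_upd_idle[OF False] by metis
  qed
next
  case (Exists y \<phi>)
  show ?case
  proof (cases "x \<in> fo_fv (Exists y \<phi>)")
    case True
    with Exists.prems have x: "y \<noteq> x" "y \<notin> tm_vars s" "free_for x s \<phi>" by auto
    then have "fo_sat A (\<sigma>(y := d)) (fo_subst x s \<phi>) = fo_sat A (\<sigma>(x := tm_val A \<sigma> s, y := d)) \<phi>" for d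
      using Exists.IH[of "\<sigma>(y := d)"] by (metis fun_upd_twist tm_val_fun_upd_idle)
    with x show ?thesis by (simp only: fo_sat.simps fo_subst.simps if_False)
  next
    case False
    then show ?thesis
      using fo_subst_idle[OF False] fo_sat_fun_upd_idle[OF False] by metis
  qed
qed (auto simp: tm_val_subst)

text \<open>
  Elements of the canonical structure are classes of terms, represented by the images under \<open>e\<close>
  of chosen terms.
\<close>

definition cval :: "('v fo \<Rightarrow> bool) \<Rightarrow> ('v tm \<Rightarrow> 'a) \<Rightarrow> 'v tm \<Rightarrow> 'a" where
  "cval q e t = e (SOME s. q (Eq t s))"

text \<open>Order and step are read off from arbitrary representatives; \<open>less_cong\<close> and
  \<open>eq_Fn\<close> will show that the choice is immaterial.\<close>

definition canon :: "('v fo \<Rightarrow> bool) \<Rightarrow> ('v tm \<Rightarrow> 'a) \<Rightarrow> 'a ordstr" where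
  "canon q e = \<lparr>carr = range (cval q e),
     lt = (\<lambda>a b. \<exists>s t. a = cval q e s \<and> b = cval q e t \<and> q (Less s t)),
     origin = cval q e Cst,
     step = (\<lambda>a. cval q e (Fn (SOME t. cval q e t = a)))\<rparr>"

lemma cval_cong: "(\<And>s t. q (Eq s t) = q' (Eq s t)) \<Longrightarrow> cval q e = cval q' e"
  unfolding cval_def by simp

text \<open>The structure depends on atomic formulas alone, and these are what the label axioms
  transport. Hence provably equal labels yield literally the same node.\<close>

lemma canon_cong:
  "(\<And>s t. q (Eq s t) = q' (Eq s t)) \<Longrightarrow> (\<And>s t. q (Less s t) = q' (Less s t)) \<Longrightarrow>
   canon q e = canon q' e"
  unfolding canon_def using cval_cong[of q q' e] by simp

text \<open>What the external theory (\<open>E\<close> = \<open>ERel\<close>) and the internal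
  theory of each label (\<open>E\<close> = \<open>LabR T\<close>) have in common. The injection
  \<open>e\<close> places terms inside the carrier type.\<close>

locale rel_theory =
  fixes G :: "fm set" and E :: "'v rfm \<Rightarrow> fm" and fv :: "fm \<Rightarrow> 'v set" and e :: "'v tm \<Rightarrow> 'a"
  assumes closed: "closed G"
    and rel_axiom: "rel_axiom E S \<Longrightarrow> mtl_rule {} S"
    and rel_rule: "rel_rule E fv Ps S \<Longrightarrow> mtl_rule Ps S"
    and witness_left: "E \<rho> \<in> G \<Longrightarrow> finite B \<Longrightarrow> wit_left E B G \<rho>"
    and witness_right: "E \<rho> \<notin> G \<Longrightarrow> wit_right E (- G) \<rho>"
    and infinite_vars: "infinite (UNIV :: 'v set)"
    and inj: "inj e"
begin

abbreviation q :: "'v fo \<Rightarrow> bool" where "q \<phi> \<equiv> E (FO \<phi>) \<in> G"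
abbreviation val :: "'v tm \<Rightarrow> 'a" where "val \<equiv> cval q e"
abbreviation Q :: "'a ordstr" where "Q \<equiv> canon q e"
abbreviation asg :: "'v \<Rightarrow> 'a" where "asg x \<equiv> val (Var x)"

lemma axiomD: "rel_axiom E (\<Gamma> \<turnstile> \<Delta>) \<Longrightarrow> set \<Gamma> \<subseteq> G \<Longrightarrow> \<exists>B\<in>set \<Delta>. B \<in> G"
  by (rule closedD[OF closed provable.intros[OF rel_axiom]]) auto

lemma prop_rule_le: "prop_rule Neg Conj Disj Imp (\<lambda>\<phi>. E (FO \<phi>)) \<le> mtl_rule"
  by (auto intro: rel_rule rel_rule.connective)

lemmas connectives = closed_prop[OF closed prop_rule_le]

lemma fresh: fixes s t :: "'v tm" shows "\<exists>z. z \<notin> tm_vars s \<and> z \<notin> tm_vars t"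
  using ex_new_if_finite[OF infinite_vars, of "tm_vars s \<union> tm_vars t"] by (auto simp: finite_tm_vars)

lemma eq_refl: "q (Eq t t)"
  using axiomD[OF rel_axiom.eq_refl[of E t]] by simp

lemma eq_subst: "atomic \<rho> \<Longrightarrow> q (Eq s t) \<Longrightarrow> q (fo_subst z s \<rho>) \<Longrightarrow> q (fo_subst z t \<rho>)"
  using axiomD[OF rel_axiom.eq_subst[of \<rho> E s t z]] by simp

text \<open>A fresh variable \<open>z\<close> marks the single occurrence to be replaced, leaving
  the other occurrences of \<open>s\<close> untouched. The next lemmas use the same device.\<close>

lemma eq_sym: assumes "q (Eq s t)" shows "q (Eq t s)"
proof -
  obtain z where "z \<notin> tm_vars s" using fresh by blast
  then show ?thesis
    using eq_subst[of "Eq (Var z) s" s t z] assms eq_refl[of s] by (simp add: tm_subst_idle)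
qed

lemma eq_trans: assumes "q (Eq s t)" "q (Eq t u)" shows "q (Eq s u)"
proof -
  obtain z where "z \<notin> tm_vars s" using fresh by blast
  then show ?thesis using eq_subst[of "Eq s (Var z)" t u z] assms by (simp add: tm_subst_idle)
qed

lemma eq_Fn: assumes "q (Eq s t)" shows "q (Eq (Fn s) (Fn t))"
proof -
  obtain z where "z \<notin> tm_vars s" using fresh by blast
  then show ?thesis
    using eq_subst[of "Eq (Fn s) (Fn (Var z))" s t z] assms eq_refl[of "Fn s"] by (simp add: tm_subst_idle)
qed

lemma less_cong: assumes "q (Eq s s')" "q (Eq t t')" "q (Less s t)" shows "q (Less s' t')"
proof -
  obtain z where "z \<notin> tm_vars t" using fresh by blast
  then have "q (Less s' t)" using eq_subst[of "Less (Var z) t" s s' z] assms by (simp add: tm_subst_idle)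
  obtain z where "z \<notin> tm_vars s'" using fresh by blast
  with \<open>q (Less s' t)\<close> show ?thesis
    using eq_subst[of "Less s' (Var z)" t t' z] assms by (simp add: tm_subst_idle)
qed

text \<open>Each term is equal in \<open>G\<close> to its chosen representative, and injectivity of
  \<open>e\<close> recovers that representative from the value.\<close>

lemma val_eq_iff: "val s = val t \<longleftrightarrow> q (Eq s t)"
proof
  have some: "q (Eq t (SOME s. q (Eq t s)))" for t by (rule someI, rule eq_refl)
  assume "val s = val t"
  then have "(SOME u. q (Eq s u)) = (SOME u. q (Eq t u))" unfolding cval_def using inj by (simp add: inj_eq)
  with some[of s] some[of t] show "q (Eq s t)" by (metis eq_sym eq_trans)
next
  assume "q (Eq s t)"
  then have "q (Eq s u) \<longleftrightarrow> q (Eq t u)" for u using eq_sym eq_trans by blast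
  then show "val s = val t" unfolding cval_def by simp
qed

lemma carr_canon: "carr Q = range val"
  by (simp add: canon_def)

lemma lt_canon: "lt Q (val s) (val t) \<longleftrightarrow> q (Less s t)"
  unfolding canon_def ordstr.simps val_eq_iff using less_cong eq_refl eq_sym by blast

lemma origin_canon: "origin Q = val Cst"
  by (simp add: canon_def)

lemma step_canon: "step Q (val t) = val (Fn t)"
proof -
  have "val (SOME s. val s = val t) = val t" by (rule someI, rule refl)
  then show ?thesis by (simp add: canon_def val_eq_iff eq_Fn)
qed

lemma step_pow_canon: "(step Q ^^ n) (val t) = val ((Fn ^^ n) t)"
  by (induction n) (auto simp: step_canon)

lemma tm_val_canon: "tm_val Q asg t = val t"
  by (induction t) (auto simp: step_canon origin_canon)

lemma le_canon: "le Q (val s) (val t) \<longleftrightarrow> q (Leq s t)"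
  by (simp add: le_def lt_canon val_eq_iff connectives)

lemma in_interval_canon: "in_interval Q I (val t) (val s) \<longleftrightarrow> (\<forall>\<phi>\<in>set (bounds I t s). q \<phi>)"
proof (cases "Rep_interval I")
  case (fields b m u)
  then show ?thesis
    unfolding in_interval_def bounds_def
    by (cases u; cases "the u") (auto simp: step_pow_canon lt_canon le_canon)
qed

text \<open>The formula \<exists>z. z = t is provable, and its witnesses in \<open>G\<close> can
  avoid any finite set. So variables alone name all elements.\<close>

lemma named: assumes "finite B" shows "\<exists>y. y \<notin> B \<and> val (Var y) = val t"
proof -
  obtain z where z: "z \<notin> tm_vars t" using fresh by blast
  let ?\<phi> = "Eq (Var z) t"
  have "provable ([] \<turnstile> E (FO (fo_subst z t ?\<phi>)) # [])"
    using z by (auto simp: tm_subst_idle intro: provable.intros[OF rel_axiom[OF rel_axiom.eq_refl]])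
  then have "provable ([] \<turnstile> E (FO (Exists z ?\<phi>)) # [])"
    by (intro provable.intros[OF rel_rule[OF rel_rule.existsR[of z t]]]) auto
  then have "q (Exists z ?\<phi>)" using closedD[OF closed] by fastforce
  from witness_left[OF this assms] z show ?thesis by (auto simp: val_eq_iff tm_subst_idle)
qed

lemma infOr: "E (InfOr t) \<in> G"
  using axiomD[OF rel_axiom.cofinal[of E t]] by simp

text \<open>The disjunct chosen during saturation bounds \<open>t\<close>; this excludes elements
  above all iterates of the origin.\<close>

lemma cofinal: "\<exists>n. q (Less t ((Fn ^^ n) Cst))"
  using witness_left[OF infOr, of "{}"] by simp

lemma admissible_canon: "admissible Q"
proof -
  have irrefl: "\<not> q (Less t t)" for t
    using axiomD[OF rel_axiom.less_irrefl[of E t]] by auto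
  have trans: "q (Less s t) \<Longrightarrow> q (Less t u) \<Longrightarrow> q (Less s u)" for s t u
    using axiomD[OF rel_axiom.less_trans[of E s t u]] by simp
  have total: "q (Less s t) \<or> q (Eq s t) \<or> q (Less t s)" for s t
    using axiomD[OF rel_axiom.less_total[of E s t]] by simp
  have least: "q (Less Cst t) \<or> q (Eq Cst t)" for t
    using axiomD[OF rel_axiom.least[of E t]] by simp
  have Fn: "q (Less t (Fn t))" for t
    using axiomD[OF rel_axiom.less_Fn[of E t]] by simp
  have mono: "q (Less s t) \<Longrightarrow> q (Less (Fn s) (Fn t))" for s t
    using axiomD[OF rel_axiom.Fn_mono[of E s t]] by simp
  have dense: "\<exists>u. q (Less s u) \<and> q (Less u t)" if "q (Less s t)" for s t
  proof -
    obtain z where z: "z \<notin> tm_vars s" "z \<notin> tm_vars t" using fresh by blast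
    \<comment> \<open>The density axiom only provides an existential formula; saturation turns it
      into an actual intermediate term.\<close>
    then have "q (Exists z (Conj (Less s (Var z)) (Less (Var z) t)))"
      using axiomD[OF rel_axiom.dense[of z s t E]] that by simp
    from witness_left[OF this, of "{}"] z show ?thesis by (auto simp: connectives tm_subst_idle)
  qed
  show ?thesis
    unfolding admissible_def carr_canon
  proof (intro conjI)
    show "irreflp_on (range val) (lt Q)" by (auto intro!: irreflp_onI simp: lt_canon irrefl)
    show "transp_on (range val) (lt Q)" by (auto intro!: transp_onI simp: lt_canon dest: trans)
    show "totalp_on (range val) (lt Q)"
      using total by (auto intro!: totalp_onI simp: lt_canon val_eq_iff) blast
    show "monotone_on (range val) (lt Q) (lt Q) (step Q)"
      by (auto intro!: monotone_onI simp: lt_canon step_canon mono)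
    show "\<forall>a\<in>range val. \<exists>n. le Q a ((step Q ^^ n) (origin Q))"
      using cofinal by (auto simp: origin_canon step_pow_canon le_canon connectives)
    show "\<forall>a\<in>range val. \<forall>b\<in>range val. lt Q a b \<longrightarrow> (\<exists>c\<in>range val. lt Q a c \<and> lt Q c b)"
      using dense by (auto simp: lt_canon)
    show "\<forall>a\<in>range val. le Q (origin Q) a"
      using least by (auto simp: origin_canon le_canon connectives)
    show "\<forall>a\<in>range val. \<exists>b\<in>range val. lt Q a b" using Fn by (auto simp: lt_canon)
    show "\<forall>a\<in>range val. lt Q a (step Q a)" using Fn by (auto simp: lt_canon step_canon)
  qed (auto simp: origin_canon step_canon)
qed

section \<open>The truth lemma for relational formulas\<close>

lemma forallL: assumes "q (Forall x \<phi>)" "free_for x t \<phi>" shows "q (fo_subst x t \<phi>)"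
proof -
  have "provable ([] @ [E (FO (Forall x \<phi>))] \<turnstile> [E (FO (fo_subst x t \<phi>))])"
    by (rule provable.intros[OF rel_rule[OF rel_rule.forallL[OF assms(2)]]]) (auto intro: provable_common)
  with assms(1) show ?thesis by (fastforce dest!: closedD[OF closed])
qed

lemma existsR: assumes "q (fo_subst x t \<phi>)" "free_for x t \<phi>" shows "q (Exists x \<phi>)"
proof -
  have "provable ([E (FO (fo_subst x t \<phi>))] \<turnstile> [E (FO (Exists x \<phi>))])"
    by (rule provable.intros[OF rel_rule[OF rel_rule.existsR[OF assms(2)]]]) (auto intro: provable_common)
  with assms(1) show ?thesis by (fastforce dest!: closedD[OF closed])
qed

lemma fo_truth: "fo_sat Q asg \<phi> \<longleftrightarrow> q \<phi>"
proof (induction "size \<phi>" arbitrary: \<phi> rule: less_induct)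
  case less
  have inst: "fo_sat Q (asg(x := asg y)) \<psi> \<longleftrightarrow> q (fo_subst x (Var y) \<psi>)"
    if "free_for x (Var y) \<psi>" "size \<psi> < size \<phi>" for x y \<psi>
    using less[of "fo_subst x (Var y) \<psi>"] fo_sat_subst[OF that(1), of Q asg] that(2)
    by (simp add: size_fo_subst)
  show ?case
  proof (cases \<phi>)
    case (Forall x \<psi>)
    have "(\<forall>t. fo_sat Q (asg(x := val t)) \<psi>) \<longleftrightarrow> q (Forall x \<psi>)"
    proof
      assume all: "\<forall>t. fo_sat Q (asg(x := val t)) \<psi>"
      show "q (Forall x \<psi>)"
        using witness_right[of "FO (Forall x \<psi>)"] all inst[of x _ \<psi>] Forall by auto
    next
      assume q: "q (Forall x \<psi>)"
      show "\<forall>t. fo_sat Q (asg(x := val t)) \<psi>"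
      proof
        fix t
        \<comment> \<open>The arbitrary term \<open>t\<close> may be captured or enlarge the
          formula, so it is replaced by a harmless variable with the same value.\<close>
        obtain y where "free_for x (Var y) \<psi>" "val (Var y) = val t"
          using named[OF finite_not_free_for[of x \<psi>], of t] by auto
        then show "fo_sat Q (asg(x := val t)) \<psi>" using forallL[OF q] inst[of x y \<psi>] Forall by simp
      qed
    qed
    with Forall show ?thesis by (simp add: carr_canon)
  next
    case (Exists x \<psi>)
    have "(\<exists>t. fo_sat Q (asg(x := val t)) \<psi>) \<longleftrightarrow> q (Exists x \<psi>)"
    proof
      assume "\<exists>t. fo_sat Q (asg(x := val t)) \<psi>"
      then obtain t where t: "fo_sat Q (asg(x := val t)) \<psi>" ..
      obtain y where "free_for x (Var y) \<psi>" "val (Var y) = val t"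
        using named[OF finite_not_free_for[of x \<psi>], of t] by auto
      then show "q (Exists x \<psi>)" using existsR[of x "Var y" \<psi>] inst[of x y \<psi>] t Exists by simp
    next
      assume "q (Exists x \<psi>)"
      then show "\<exists>t. fo_sat Q (asg(x := val t)) \<psi>"
        using witness_left[of "FO (Exists x \<psi>)" "{}"] inst[of x _ \<psi>] Exists by auto
    qed
    with Exists show ?thesis by (simp add: carr_canon)
  qed (use less in \<open>auto simp: connectives tm_val_canon lt_canon val_eq_iff\<close>)
qed

text \<open>For the infinitary formulas both sides hold outright: the cofinality axiom puts them
  into \<open>G\<close>, and \<open>cofinal\<close> makes them true.\<close>

lemma rfm_truth: "rfm_sat Q asg \<rho> \<longleftrightarrow> E \<rho> \<in> G"
proof (cases \<rho>)
  case (FO \<phi>)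
  then show ?thesis by (simp add: fo_truth)
next
  case (InfOr t)
  then show ?thesis using infOr[of t] cofinal[of t] by (simp add: fo_truth del: fo_sat.simps)
next
  case (AllInfOr x)
  have "provable ([] \<turnstile> E (AllInfOr x) # [])"
    by (rule provable.intros[OF rel_rule[OF rel_rule.allInfOrR]])
      (auto intro: provable.intros[OF rel_axiom[OF rel_axiom.cofinal]])
  then have "E (AllInfOr x) \<in> G" using closedD[OF closed] by fastforce
  moreover have "\<exists>n. lt Q (val t) (tm_val Q (asg(x := val t)) ((Fn ^^ n) Cst))" for t
  proof -
    have "tm_val Q \<sigma> ((Fn ^^ n) Cst) = val ((Fn ^^ n) Cst)" for \<sigma> :: "'v \<Rightarrow> 'a" and n
      by (induction n) (auto simp: step_canon origin_canon)
    then show ?thesis using cofinal by (simp add: lt_canon)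
  qed
  ultimately show ?thesis using AllInfOr by (auto simp: carr_canon)
qed

end


section \<open>Completeness\<close>

lemma ex_inj_countable:
  assumes "infinite (UNIV :: 'a set)"
  shows "\<exists>e :: 'b :: countable \<Rightarrow> 'a. inj e"
proof -
  obtain f :: "nat \<Rightarrow> 'a" where "inj f" using infinite_countable_subset[OF assms] by blast
  then have "inj (f \<circ> to_nat :: 'b \<Rightarrow> 'a)" by (intro inj_compose inj_to_nat)
  then show ?thesis by blast
qed

lemma saturated_model:
  assumes G: "saturated G" and infm: "infinite (UNIV :: 'm set)" and infn: "infinite (UNIV :: 'n set)"
  shows "\<exists>\<M> :: ('m, 'n) struct. is_structure \<M> \<and> (\<forall>A. sat \<M> A \<longleftrightarrow> A \<in> G)"
proof -
  obtain e :: "evar tm \<Rightarrow> 'm" where e: "inj e" using ex_inj_countable[OF infm] by blast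
  obtain i :: "ivar tm \<Rightarrow> 'n" where i: "inj i" using ex_inj_countable[OF infn] by blast
  have clG: "closed G" using G unfolding saturated_def by blast
  have witL: "A \<in> G \<Longrightarrow> finite B \<Longrightarrow> finite C \<Longrightarrow> witness_left B C G A" for A B C
    using G unfolding saturated_def by blast
  have witR: "A \<notin> G \<Longrightarrow> witness_right G (- G) A" for A
    using G unfolding saturated_def by blast
  interpret ext: rel_theory G ERel ext_fv e
    using clG mtl_rule.ext_axiom mtl_rule.ext_rel witL[of "ERel _" _ "{}"] witR[of "ERel _"]
      infinite_evar e
    by unfold_locales auto
  have int: "rel_theory G (LabR T) int_fv i" for T
    using clG mtl_rule.int_axiom mtl_rule.int_rel witL[of "LabR _ _" "{}"] witR[of "LabR _ _"]
      infinite_ivar i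
    by unfold_locales auto
  define ival where "ival T = cval (\<lambda>\<phi>. LabR T (FO \<phi>) \<in> G) i" for T
  define inode where "inode T = canon (\<lambda>\<phi>. LabR T (FO \<phi>) \<in> G) i" for T
  \<comment> \<open>The node at a class is built from one chosen label of that class;
    \<open>pick_R\<close> and \<open>pick_L\<close> transfer membership to every other
    label.\<close>
  define pick where "pick a = (SOME T. ext.val T = a)" for a
  define \<M> :: "('m, 'n) struct" where "\<M> = \<lparr>base = ext.Q, node = (\<lambda>a. inode (pick a)),
    letter = (\<lambda>a k. {ival (pick a) t | t. LabL (pick a) (At t (Letter k)) \<in> G}),
    easg = ext.asg, iasg = (\<lambda>a x. ival (pick a) (Var x))\<rparr>"
  have pick: "ERel (FO (Eq (pick (ext.val T)) T)) \<in> G" for T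
    using someI[of "\<lambda>S. ext.val S = ext.val T" T] by (simp add: pick_def ext.val_eq_iff)
  have label_eqR: "LabR S (FO \<rho>) \<in> G" if "ERel (FO (Eq T S)) \<in> G" "atomic \<rho>" "LabR T (FO \<rho>) \<in> G" for S T \<rho>
    using closedD[OF clG provable.intros[OF mtl_rule.label_eqR[of \<rho> T S]]] that by auto
  have label_eqL: "LabL S (At t \<psi>) \<in> G" if "ERel (FO (Eq T S)) \<in> G" "LabL T (At t \<psi>) \<in> G" for S T t \<psi>
    using closedD[OF clG provable.intros[OF mtl_rule.label_eqL[of T S t \<psi>]]] that by auto
  have letter_eq: "LabL T (At s (Letter k)) \<in> G"
    if "LabR T (FO (Eq t s)) \<in> G" "LabL T (At t (Letter k)) \<in> G" for T s t k
    using closedD[OF clG provable.intros[OF mtl_rule.letter_eq[of T t s k]]] that by auto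
  have pick_R: "LabR (pick (ext.val T)) (FO \<rho>) \<in> G \<longleftrightarrow> LabR T (FO \<rho>) \<in> G" if "atomic \<rho>" for T \<rho>
    using label_eqR[OF _ that] pick[of T] ext.eq_sym by blast
  have pick_L: "LabL (pick (ext.val T)) (At t \<psi>) \<in> G \<longleftrightarrow> LabL T (At t \<psi>) \<in> G" for T t \<psi>
    using label_eqL pick[of T] ext.eq_sym by blast
  have pick_val: "ival (pick (ext.val T)) = ival T" for T
    unfolding ival_def by (rule cval_cong) (simp add: pick_R)
  have node: "node \<M> (ext.val T) = inode T" for T
    unfolding \<M>_def struct.simps inode_def by (rule canon_cong) (simp_all add: pick_R)
  have iasg: "iasg \<M> (ext.val T) = (\<lambda>x. ival T (Var x))" for T
    by (simp add: \<M>_def pick_val)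
  \<comment> \<open>The axiom \<open>letter_eq\<close> makes the interpretation of a letter
    independent of the internal term naming the point.\<close>
  have letter: "ival T t \<in> letter \<M> (ext.val T) k \<longleftrightarrow> LabL T (At t (Letter k)) \<in> G" for T t k
  proof -
    have eq: "ival T t = ival T s \<longleftrightarrow> LabR T (FO (Eq t s)) \<in> G" for s t
      unfolding ival_def by (rule rel_theory.val_eq_iff[OF int])
    have "letter \<M> (ext.val T) k = {ival T s | s. LabL T (At s (Letter k)) \<in> G}"
      by (simp add: \<M>_def pick_val pick_L)
    moreover have "LabL T (At t (Letter k)) \<in> G"
      if "ival T t = ival T s" "LabL T (At s (Letter k)) \<in> G" for s
      using letter_eq[of T s t k] that eq[of s t] by simp
    ultimately show ?thesis by auto
  qed
  have base: "base \<M> = ext.Q" "easg \<M> = ext.asg" by (simp_all add: \<M>_def)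
  note carr = rel_theory.carr_canon[OF int, folded ival_def inode_def]
  have int_prop: "prop_rule TNeg TConj TDisj TImp (\<lambda>\<eta>. LabL T (At t \<eta>)) \<le> mtl_rule" for T t
    by (auto intro: mtl_rule.int_prop)
  have ext_prop: "prop_rule LNeg LConj LDisj LImp (LabL T) \<le> mtl_rule" for T
    by (auto intro: mtl_rule.ext_prop)
  have int_box: "box_rule (\<lambda>t \<eta>. LabL T (At t \<eta>)) TBox (LabR T) int_fv \<le> mtl_rule" for T
    by (auto intro: mtl_rule.int_box)
  have ext_box: "box_rule LabL LBox ERel ext_fv \<le> mtl_rule"
    by (auto intro: mtl_rule.ext_box)
  note connectives = closed_prop[OF clG int_prop] closed_prop[OF clG ext_prop]
  have "is_structure \<M>"
    unfolding is_structure_def base ext.carr_canon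
  proof (intro conjI ballI)
    fix a assume "a \<in> range ext.val"
    then obtain T where a: "a = ext.val T" by blast
    show "admissible (node \<M> a)"
      unfolding a node inode_def by (rule rel_theory.admissible_canon[OF int])
    show "range (iasg \<M> a) \<subseteq> carr (node \<M> a)" unfolding a node iasg carr by blast
    show "\<forall>k. letter \<M> a k \<subseteq> carr (node \<M> a)"
      unfolding a node carr by (auto simp: \<M>_def pick_val)
  qed (auto simp: ext.admissible_canon)
  moreover have "sat \<M> A \<longleftrightarrow> A \<in> G" for A
  proof -
    \<comment> \<open>The term \<open>t\<close> is arbitrary in the induction because a box moves to
      other points; in \<open>lfm\<close> the label \<open>T\<close> varies for the same
      reason.\<close>
    have tfm: "tfm_sat (inode T) (letter \<M> (ext.val T)) (ival T t) \<psi> \<longleftrightarrow> LabL T (At t \<psi>) \<in> G" for T t \<psi>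
    proof (induction \<psi> arbitrary: t)
      case (Letter k)
      then show ?case by (simp add: letter)
    next
      case (TBox I \<psi>)
      have "LabL T (At t (TBox I \<psi>)) \<in> G \<longleftrightarrow>
        (\<forall>s. (\<forall>\<phi>\<in>set (bounds I t s). LabR T (FO \<phi>) \<in> G) \<longrightarrow> LabL T (At s \<psi>) \<in> G)"
        by (rule closed_box[OF clG int_box]) (use witR in fastforce)
      then show ?case
        using TBox.IH rel_theory.in_interval_canon[OF int, folded ival_def inode_def, of T I t]
        by (simp add: carr)
    qed (simp_all add: connectives)
    have lfm: "lfm_sat \<M> (ext.val T) \<alpha> \<longleftrightarrow> LabL T \<alpha> \<in> G" for T \<alpha>
    proof (induction \<alpha> arbitrary: T)
      case (At t \<psi>)
      have "tm_val (inode T) (\<lambda>x. ival T (Var x)) t = ival T t"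
        unfolding ival_def inode_def by (rule rel_theory.tm_val_canon[OF int])
      then show ?case using tfm[of T t \<psi>] by (simp add: node iasg)
    next
      case (LBox I \<alpha>)
      have "LabL T (LBox I \<alpha>) \<in> G \<longleftrightarrow>
        (\<forall>S. (\<forall>\<phi>\<in>set (bounds I T S). ERel (FO \<phi>) \<in> G) \<longrightarrow> LabL S \<alpha> \<in> G)"
        by (rule closed_box[OF clG ext_box]) (use witR in fastforce)
      then show ?case
        using LBox.IH by (simp add: base ext.carr_canon ext.in_interval_canon)
    qed (simp_all add: connectives)
    show ?thesis
    proof (cases A)
      case (ERel \<rho>)
      then show ?thesis by (simp add: base ext.rfm_truth)
    next
      case (LabR T \<rho>)
      then show ?thesis
        using rel_theory.rfm_truth[OF int, folded ival_def inode_def, of T \<rho>]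
        by (simp add: base ext.tm_val_canon node iasg)
    next
      case (LabL T \<alpha>)
      then show ?thesis by (simp add: base ext.tm_val_canon lfm)
    qed
  qed
  ultimately show ?thesis by blast
qed

text \<open>Validity is required only over one pair of infinite carrier types, which follows from
  validity in all structures. An unprovable sequent already fails in a countable structure placed
  inside them.\<close>

theorem corollary5p2:
  fixes \<Gamma> \<Delta> :: "fm list"
  assumes "infinite (UNIV :: 'm set)" and "infinite (UNIV :: 'n set)"
    and "\<And>\<M> :: ('m, 'n) struct. is_structure \<M> \<Longrightarrow> true_in \<M> (\<Gamma> \<turnstile> \<Delta>)"
  shows "provable (\<Gamma> \<turnstile> \<Delta>)"
proof (rule ccontr)
  assume "\<not> provable (\<Gamma> \<turnstile> \<Delta>)"
  then obtain G where G: "saturated G" "set \<Gamma> \<subseteq> G" "set \<Delta> \<inter> G = {}"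
    using saturated_extension by blast
  obtain \<M> :: "('m, 'n) struct" where \<M>: "is_structure \<M>" "\<And>A. sat \<M> A \<longleftrightarrow> A \<in> G"
    using saturated_model[OF G(1) assms(1,2)] by blast
  \<comment> \<open>The structure satisfies exactly \<open>G\<close>, hence all of \<Gamma> and
    nothing of \<Delta>.\<close>
  from assms(3)[OF \<M>(1)] \<M>(2) G(2,3) show False by auto
qed

end
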